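(* Let $U$ be an admissible desired state, $\gamma\ge 0$ and $u|_{\Gamma_D}=U|_{\Gamma_D}$. Let $f_B^{n+1}$ be the linear feedback control law defined, for all $v\in H^1_{\Gamma_D}(\Omega)$, by $$\langle f_B^{n+1},v\rangle=\langle F_B^{n+1},v\rangle+\widetilde c(u^{n+1}-U^{n+1};U^{n+1},v)-\gamma\,\langle u^{n+1}-U^{n+1},v\rangle,$$ where $$\langle F_B^{n+1},v\rangle=\int_\Omega\frac{U^{n+1}-U^n}{\Delta t}\cdot v\,dx+\nu\,a(U^{n+1},v)+\widetilde c(U^{n+1};U^{n+1},v).$$ Consider the fully discrete controlled Navier--Stokes problem $$\begin{cases}\displaystyle\int_\Omega\frac{u^{n+1}-u^n}{\Delta t}\cdot v_h\,dx+\nu\,a(u^{n+1},v_h)+\widetilde c(u^{n+1};u^{n+1},v_h)-b(v_h,p^{n+1})=\langle f^{n+1},v_h\rangle & \forall v_h\in V_h,\\ b(u^{n+1},q_h)=0 & \forall q_h\in Q_h.\end{cases}$$ (i) If $(u^{n+1},p^{n+1},f_B^{n+1})$ is a solution of this problem (i.e. with $f^{n+1}=f_B^{n+1}$), then the solution is admissible, i.e. $\|u^{n+1}-U^{n+1}\|_{L^2}^2\le\|u^n-U^n\|_{L^2}^2$ for $n=0,\dots,N_T-1$; (ii) and $$\|u^{n+1}-U^{n+1}\|_{L^2}^2\le\left(\frac{1}{1+2\Delta t(\gamma+C_0\nu)}\right)^{n+1}\|u_0^h-U_0^h\|_{L^2}^2 .$$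
   Context: Setting: $\Omega\subset\mathbb R^2$ is the spatial domain, with $\partial\Omega=\overline{\Gamma_D}\cup\overline{\Gamma_N}$, $\Gamma_D\cap\Gamma_N=\emptyset$; $\nu$ is the kinematic viscosity; $\Delta t$ is the time step, $t^n=n\Delta t$ for $n=0,\dots,N_T$, $T=N_T\Delta t$. A superscript $n$ denotes evaluation at time $t^n$. $u_D$ is a Dirichlet datum on $\Gamma_D$; $H^1_{u_D}(\Omega)$ is the set of (vector valued) functions in $H^1(\Omega)$ equal to $u_D$ on $\Gamma_D$, and $H^1_{\Gamma_D}(\Omega)$ the space of (vector valued) functions in $H^1(\Omega)$ vanishing on $\Gamma_D$. $\langle\cdot,\cdot\rangle$ is the $L^2(\Omega)$ pairing. Discretization: implicit Euler in time and $\mathbb P^2$--$\mathbb P^1$ Taylor--Hood finite elements in space; $u^n$ and $p^n$ are the finite element velocity and pressure at $t^n$, $V_h\subset H^1_{\Gamma_D}(\Omega)$ is the finite element space of velocity test functions, and $Q_h\subset L^2(\Omega)$ is the finite element pressure space. $u_0^h$ and $U_0^h$ are the discrete velocity and the desired state at the initial time. Admissible desired state: $U$ is divergence free (hence $b(U^{n+1},q_h)=0$ for all $q_h\in Q_h$ at each time instance), satisfies the same Dirichlet boundary condition on $\Gamma_D$ as the velocity, and $U\in C((0,T),H^1_{u_D}(\Omega)\cap H^2(\Omega))$ with $U_t\in C((0,T),H^1(\Omega))$. Forms: $a(u,v)=\int_\Omega\nabla u:\nabla v\,dx$, $\;b(v,p)=\int_\Omega p\,\nabla\cdot v\,dx$,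 $\;c(w;u,v)=\int_\Omega (w\cdot\nabla)u\cdot v\,dx$, and the skew-symmetric form $\widetilde c(u;v,z)=\tfrac12\,[\,c(u;v,z)-c(u;z,v)\,]$. Poincaré constant: $C_0=C_P^{-1}$, where $C_P$ is the constant in the Poincaré inequality $\|v\|_{L^2}^2\le C_P\|\nabla v\|_{L^2}^2$ for all $v\in H^1_0(\Omega)$.
   Formalization: The desired states U^{n+1} are additionally assumed to lie in the finite element velocity space, and the Poincaré constant C_P is taken for functions vanishing on Γ_D only (not H^1_0); without these the claim fails. *)

theory Defs
  imports "HOL-Analysis.Analysis"
begin

type_synonym sfield = "real^2 \<Rightarrow> real"
type_synonym vfield = "real^2 \<Rightarrow> real^2"

section \<open>Lebesgue and Sobolev spaces\<close>

text \<open>Functions are everywhere defined representatives; only their values in the domain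
  matter, and those only up to null sets.\<close>

definition L2 :: "(real^2) set \<Rightarrow> (real^2 \<Rightarrow> 'a::euclidean_space) set" where
  "L2 \<Omega> = {f. f \<in> borel_measurable (lebesgue_on \<Omega>) \<and>
              integrable (lebesgue_on \<Omega>) (\<lambda>x. (norm (f x))\<^sup>2)}"

definition l2_ip :: "(real^2) set \<Rightarrow> (real^2 \<Rightarrow> 'a::euclidean_space) \<Rightarrow> (real^2 \<Rightarrow> 'a) \<Rightarrow> real" where
  "l2_ip \<Omega> f g = (LINT x|lebesgue_on \<Omega>. f x \<bullet> g x)"

definition l2_norm :: "(real^2) set \<Rightarrow> (real^2 \<Rightarrow> 'a::euclidean_space) \<Rightarrow> real" where
  "l2_norm \<Omega> f = sqrt (LINT x|lebesgue_on \<Omega>. (norm (f x))\<^sup>2)"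

definition pd :: "2 \<Rightarrow> sfield \<Rightarrow> sfield" where
  "pd i f x = frechet_derivative f (at x) (axis i 1)"

primrec Ck :: "nat \<Rightarrow> sfield \<Rightarrow> bool" where
  "Ck 0 f \<longleftrightarrow> continuous_on UNIV f"
| "Ck (Suc k) f \<longleftrightarrow> (\<forall>x. f differentiable (at x)) \<and> (\<forall>i. Ck k (pd i f))"

definition smooth :: "sfield \<Rightarrow> bool" where
  "smooth f \<longleftrightarrow> (\<forall>k. Ck k f)"

definition test_functions :: "(real^2) set \<Rightarrow> sfield set" where
  "test_functions \<Omega> = {\<phi>. smooth \<phi> \<and> compact (closure {x. \<phi> x \<noteq> 0}) \<and>
                          closure {x. \<phi> x \<noteq> 0} \<subseteq> \<Omega>}"

definition is_weak_pd :: "(real^2) set \<Rightarrow> 2 \<Rightarrow> sfield \<Rightarrow> sfield \<Rightarrow> bool" where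
  "is_weak_pd \<Omega> i f g \<longleftrightarrow>
     (\<forall>\<phi>\<in>test_functions \<Omega>.
        (LINT x|lebesgue_on \<Omega>. f x * pd i \<phi> x) = - (LINT x|lebesgue_on \<Omega>. g x * \<phi> x))"

definition H1 :: "(real^2) set \<Rightarrow> sfield set" where
  "H1 \<Omega> = {f \<in> L2 \<Omega>. \<forall>i. \<exists>g\<in>L2 \<Omega>. is_weak_pd \<Omega> i f g}"

text \<open>For a function in \<open>H1 \<Omega>\<close> the choice is unique almost everywhere in \<open>\<Omega>\<close>.\<close>

definition wpd :: "(real^2) set \<Rightarrow> 2 \<Rightarrow> sfield \<Rightarrow> sfield" where
  "wpd \<Omega> i f = (SOME g. g \<in> L2 \<Omega> \<and> is_weak_pd \<Omega> i f g)"

definition H2 :: "(real^2) set \<Rightarrow> sfield set" where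
  "H2 \<Omega> = {f \<in> H1 \<Omega>. \<forall>i. wpd \<Omega> i f \<in> H1 \<Omega>}"

definition h1_norm :: "(real^2) set \<Rightarrow> sfield \<Rightarrow> real" where
  "h1_norm \<Omega> f = sqrt ((l2_norm \<Omega> f)\<^sup>2 + (\<Sum>i\<in>UNIV. (l2_norm \<Omega> (wpd \<Omega> i f))\<^sup>2))"

definition h2_norm :: "(real^2) set \<Rightarrow> sfield \<Rightarrow> real" where
  "h2_norm \<Omega> f = sqrt ((l2_norm \<Omega> f)\<^sup>2 + (\<Sum>i\<in>UNIV. (h1_norm \<Omega> (wpd \<Omega> i f))\<^sup>2))"

definition cmp :: "vfield \<Rightarrow> 2 \<Rightarrow> sfield" where
  "cmp v i = (\<lambda>x. v x $ i)"

definition H1_vec :: "(real^2) set \<Rightarrow> vfield set" where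
  "H1_vec \<Omega> = {v. \<forall>i. cmp v i \<in> H1 \<Omega>}"

definition H2_vec :: "(real^2) set \<Rightarrow> vfield set" where
  "H2_vec \<Omega> = {v. \<forall>i. cmp v i \<in> H2 \<Omega>}"

definition h1_norm_vec :: "(real^2) set \<Rightarrow> vfield \<Rightarrow> real" where
  "h1_norm_vec \<Omega> v = sqrt (\<Sum>i\<in>UNIV. (h1_norm \<Omega> (cmp v i))\<^sup>2)"

definition h2_norm_vec :: "(real^2) set \<Rightarrow> vfield \<Rightarrow> real" where
  "h2_norm_vec \<Omega> v = sqrt (\<Sum>i\<in>UNIV. (h2_norm \<Omega> (cmp v i))\<^sup>2)"

text \<open>Row \<open>i\<close> of the weak Jacobian is the weak gradient of the \<open>i\<close>-th component; the inner
  product and the norm of \<open>real^2^2\<close> are those of Frobenius.\<close>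

definition wgrad :: "(real^2) set \<Rightarrow> vfield \<Rightarrow> real^2 \<Rightarrow> real^2^2" where
  "wgrad \<Omega> v x = (\<chi> i j. wpd \<Omega> j (cmp v i) x)"

definition wdiv :: "(real^2) set \<Rightarrow> vfield \<Rightarrow> sfield" where
  "wdiv \<Omega> v x = trace (wgrad \<Omega> v x)"

section \<open>Boundary values\<close>

text \<open>One-dimensional Hausdorff (arc length) measure. Boundedness is required because
  \<open>diameter\<close> is a real number with no meaning for unbounded sets.\<close>

definition hausdorff1_outer :: "(real^2) set \<Rightarrow> ennreal" where
  "hausdorff1_outer A =
     (SUP \<delta>\<in>{0::real<..}.
        INF C\<in>{C :: nat \<Rightarrow> (real^2) set. A \<subseteq> (\<Union>k. C k) \<and> (\<forall>k. bounded (C k) \<and> diameter (C k) \<le> \<delta>)}.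
          (\<Sum>k. ennreal (diameter (C k))))"

definition arc_length_measure :: "(real^2) measure" where
  "arc_length_measure = measure_of UNIV (sets borel) hausdorff1_outer"

text \<open>The trace operator is the continuous extension, from \<open>H\<^sup>1(\<Omega>)\<close> to \<open>L\<^sup>2(\<Gamma>)\<close>, of the
  restriction of smooth functions to \<open>\<Gamma>\<close>: \<open>f\<close> equals \<open>g\<close> on \<open>\<Gamma>\<close> if \<open>f\<close> is the limit in
  \<open>H\<^sup>1(\<Omega>)\<close> of functions smooth up to the boundary whose restrictions tend to \<open>g\<close> in \<open>L\<^sup>2(\<Gamma>)\<close>.\<close>

definition has_trace :: "(real^2) set \<Rightarrow> (real^2) set \<Rightarrow> sfield \<Rightarrow> sfield \<Rightarrow> bool" where
  "has_trace \<Omega> \<Gamma> f g \<longleftrightarrow>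
     g \<in> borel_measurable (restrict_space arc_length_measure \<Gamma>) \<and>
     (\<exists>\<phi> :: nat \<Rightarrow> sfield.
        (\<forall>k. smooth (\<phi> k)) \<and>
        (\<lambda>k. l2_norm \<Omega> (\<lambda>x. f x - \<phi> k x)) \<longlonglongrightarrow> 0 \<and>
        (\<forall>i. (\<lambda>k. l2_norm \<Omega> (\<lambda>x. wpd \<Omega> i f x - pd i (\<phi> k) x)) \<longlonglongrightarrow> 0) \<and>
        (\<lambda>k. \<integral>\<^sup>+x\<in>\<Gamma>. ennreal ((\<phi> k x - g x)\<^sup>2) \<partial>arc_length_measure) \<longlonglongrightarrow> 0)"

definition H1_dir :: "(real^2) set \<Rightarrow> (real^2) set \<Rightarrow> vfield \<Rightarrow> vfield set" where
  "H1_dir \<Omega> \<Gamma> g = {v \<in> H1_vec \<Omega>. \<forall>i. has_trace \<Omega> \<Gamma> (cmp v i) (cmp g i)}"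

definition H1_zero :: "(real^2) set \<Rightarrow> (real^2) set \<Rightarrow> vfield set" where
  "H1_zero \<Omega> \<Gamma> = H1_dir \<Omega> \<Gamma> (\<lambda>x. 0)"

section \<open>Forms\<close>

definition a_form :: "(real^2) set \<Rightarrow> vfield \<Rightarrow> vfield \<Rightarrow> real" where
  "a_form \<Omega> u v = (LINT x|lebesgue_on \<Omega>. wgrad \<Omega> u x \<bullet> wgrad \<Omega> v x)"

definition b_form :: "(real^2) set \<Rightarrow> vfield \<Rightarrow> sfield \<Rightarrow> real" where
  "b_form \<Omega> v p = (LINT x|lebesgue_on \<Omega>. p x * wdiv \<Omega> v x)"

definition c_form :: "(real^2) set \<Rightarrow> vfield \<Rightarrow> vfield \<Rightarrow> vfield \<Rightarrow> real" where
  "c_form \<Omega> w u v = (LINT x|lebesgue_on \<Omega>. (wgrad \<Omega> u x *v w x) \<bullet> v x)"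

definition c_skew :: "(real^2) set \<Rightarrow> vfield \<Rightarrow> vfield \<Rightarrow> vfield \<Rightarrow> real" where
  "c_skew \<Omega> u v z = (c_form \<Omega> u v z - c_form \<Omega> u z v) / 2"

section \<open>Taylor--Hood finite elements\<close>

definition is_mesh :: "(real^2) set \<Rightarrow> (real^2) set set \<Rightarrow> bool" where
  "is_mesh \<Omega> \<T> \<longleftrightarrow> triangulation \<T> \<and> (\<forall>K\<in>\<T>. 2 simplex K) \<and> \<Union>\<T> = closure \<Omega>"

definition lagrange_space :: "nat \<Rightarrow> (real^2) set \<Rightarrow> (real^2) set set \<Rightarrow> sfield set" where
  "lagrange_space k \<Omega> \<T> =
     {v. continuous_on (closure \<Omega>) v \<and>
         (\<forall>K\<in>\<T>. \<exists>c :: nat \<Rightarrow> nat \<Rightarrow> real. \<forall>x\<in>K.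
            v x = (\<Sum>i\<le>k. \<Sum>j\<le>k - i. c i j * (x $ 1) ^ i * (x $ 2) ^ j))}"

text \<open>Continuous piecewise polynomials belong to \<open>H\<^sup>1\<close>, so the membership in \<open>H1_vec\<close> is not a
  restriction.\<close>

definition velocity_space :: "(real^2) set \<Rightarrow> (real^2) set set \<Rightarrow> vfield set" where
  "velocity_space \<Omega> \<T> = {v \<in> H1_vec \<Omega>. \<forall>i. cmp v i \<in> lagrange_space 2 \<Omega> \<T>}"

definition velocity_test_space :: "(real^2) set \<Rightarrow> (real^2) set \<Rightarrow> (real^2) set set \<Rightarrow> vfield set" where
  "velocity_test_space \<Omega> \<Gamma>D \<T> = velocity_space \<Omega> \<T> \<inter> H1_zero \<Omega> \<Gamma>D"

definition pressure_space :: "(real^2) set \<Rightarrow> (real^2) set set \<Rightarrow> sfield set" where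
  "pressure_space \<Omega> \<T> = lagrange_space 1 \<Omega> \<T>"

section \<open>Desired states and the control law\<close>

definition at_step :: "real \<Rightarrow> (real \<Rightarrow> vfield) \<Rightarrow> nat \<Rightarrow> vfield" where
  "at_step dt U n = U (real n * dt)"

text \<open>Membership, boundary values and vanishing divergence are required on the closed time
  interval because the state is evaluated at both end points; continuity in time and the
  existence of the time derivative are required on the open one. The time derivative is the
  limit of the difference quotients in \<open>H\<^sup>1\<close>.\<close>

definition admissible_state ::
  "(real^2) set \<Rightarrow> (real^2) set \<Rightarrow> (real \<Rightarrow> vfield) \<Rightarrow> real \<Rightarrow> (real \<Rightarrow> vfield) \<Rightarrow> bool" where
  "admissible_state \<Omega> \<Gamma>D uD T U \<longleftrightarrow>
     (\<forall>t\<in>{0..T}. U t \<in> H1_dir \<Omega> \<Gamma>D (uD t) \<inter> H2_vec \<Omega> \<and>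
                 (AE x in lebesgue_on \<Omega>. wdiv \<Omega> (U t) x = 0)) \<and>
     (\<forall>t\<in>{0<..<T}. ((\<lambda>s. h2_norm_vec \<Omega> (\<lambda>x. U s x - U t x)) \<longlongrightarrow> 0) (at t)) \<and>
     (\<exists>Ut :: real \<Rightarrow> vfield. \<forall>t\<in>{0<..<T}.
        Ut t \<in> H1_vec \<Omega> \<and>
        ((\<lambda>s. h1_norm_vec \<Omega> (\<lambda>x. (1 / (s - t)) *\<^sub>R (U s x - U t x) - Ut t x)) \<longlongrightarrow> 0) (at t) \<and>
        ((\<lambda>s. h1_norm_vec \<Omega> (\<lambda>x. Ut s x - Ut t x)) \<longlongrightarrow> 0) (at t))"

text \<open>\<open>U1\<close> and \<open>U0\<close> are the desired states at the new and at the old time step, \<open>u1\<close> is the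
  velocity at the new one.\<close>

definition F_B :: "(real^2) set \<Rightarrow> real \<Rightarrow> real \<Rightarrow> vfield \<Rightarrow> vfield \<Rightarrow> vfield \<Rightarrow> real" where
  "F_B \<Omega> \<nu> dt U1 U0 v =
     l2_ip \<Omega> (\<lambda>x. (1 / dt) *\<^sub>R (U1 x - U0 x)) v + \<nu> * a_form \<Omega> U1 v + c_skew \<Omega> U1 U1 v"

definition f_B :: "(real^2) set \<Rightarrow> real \<Rightarrow> real \<Rightarrow> real \<Rightarrow> vfield \<Rightarrow> vfield \<Rightarrow> vfield \<Rightarrow> vfield \<Rightarrow> real" where
  "f_B \<Omega> \<nu> dt \<gamma> U1 U0 u1 v =
     F_B \<Omega> \<nu> dt U1 U0 v + c_skew \<Omega> (\<lambda>x. u1 x - U1 x) U1 v - \<gamma> * l2_ip \<Omega> (\<lambda>x. u1 x - U1 x) v"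

text \<open>\<open>f\<close> is the force as a functional: \<open>f n v\<close> is the pairing of \<open>f\<close> at step \<open>n\<close> with \<open>v\<close>.\<close>

definition discrete_ns_solution ::
  "(real^2) set \<Rightarrow> (real^2) set \<Rightarrow> (real^2) set set \<Rightarrow> real \<Rightarrow> real \<Rightarrow> nat \<Rightarrow> (real \<Rightarrow> vfield) \<Rightarrow>
   (nat \<Rightarrow> vfield) \<Rightarrow> (nat \<Rightarrow> sfield) \<Rightarrow> (nat \<Rightarrow> vfield \<Rightarrow> real) \<Rightarrow> bool" where
  "discrete_ns_solution \<Omega> \<Gamma>D \<T> \<nu> dt N uD u p f \<longleftrightarrow>
     (\<forall>n\<le>N. u n \<in> velocity_space \<Omega> \<T> \<inter> H1_dir \<Omega> \<Gamma>D (at_step dt uD n)) \<and>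
     (\<forall>n<N. p (n + 1) \<in> pressure_space \<Omega> \<T>) \<and>
     (\<forall>n<N.
        (\<forall>v\<in>velocity_test_space \<Omega> \<Gamma>D \<T>.
           l2_ip \<Omega> (\<lambda>x. (1 / dt) *\<^sub>R (u (n + 1) x - u n x)) v + \<nu> * a_form \<Omega> (u (n + 1)) v
             + c_skew \<Omega> (u (n + 1)) (u (n + 1)) v - b_form \<Omega> v (p (n + 1)) = f (n + 1) v) \<and>
        (\<forall>q\<in>pressure_space \<Omega> \<T>. b_form \<Omega> (u (n + 1)) q = 0))"

text \<open>The errors of the scheme vanish on \<open>\<Gamma>D\<close> only, so the inequality is taken on the space of
  functions vanishing there; this is \<open>H\<^sup>1\<^sub>0(\<Omega>)\<close> if \<open>\<Gamma>D\<close> is the whole boundary.\<close>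

definition poincare_constant :: "(real^2) set \<Rightarrow> (real^2) set \<Rightarrow> real \<Rightarrow> bool" where
  "poincare_constant \<Omega> \<Gamma>D C \<longleftrightarrow>
     C > 0 \<and> (\<forall>v\<in>H1_zero \<Omega> \<Gamma>D. (l2_norm \<Omega> v)\<^sup>2 \<le> C * (l2_norm \<Omega> (wgrad \<Omega> v))\<^sup>2)"

end

theory Submission
  imports Defs "HOL-Real_Asymp.Real_Asymp"
begin

text \<open>Let \<open>e\<close> and \<open>e'\<close> be the errors \<open>u - U\<close> at the old and at the new time step. Then \<open>e'\<close> vanishes on \<open>\<Gamma>D\<close> and lies in the finite element
  space, so it may be used as a test function. The feedback law removes all convective terms
  except \<open>c_skew u' e' e' = 0\<close>, and the pressure term drops out because the divergences of
  \<open>u\<close> and \<open>U\<close> are orthogonal to the discrete pressures. What remains is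
  \<open>\<langle>e' - e, e'\<rangle> + dt * (\<nu> * a e' e' + \<gamma> * \<langle>e', e'\<rangle>) = 0\<close>, and \<open>2 * \<langle>e, e'\<rangle> \<le> \<langle>e, e\<rangle> + \<langle>e', e'\<rangle>\<close>
  together with the Poincare inequality gives both claims. Since \<open>wpd\<close> is a choice, the
  linearity of the forms rests on the almost everywhere uniqueness of weak derivatives, that is, on
  the fundamental lemma of the calculus of variations.\<close>

section \<open>Smooth bump functions on boxes\<close>

text \<open>The class of these functions is closed under differentiation up to linear combinations, which
  makes the smoothness of \<open>exp (- (1 / t))\<close> at the origin an induction.\<close>

definition flat_exp :: "nat \<Rightarrow> real \<Rightarrow> real" where
  "flat_exp j t = (if t > 0 then exp (- (1 / t)) / t ^ j else 0)"

text \<open>Away from the origin this is elementary calculus. At the origin both one-sided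
  difference quotients tend to 0, since the exponential decay beats every power of
  \<open>1 / h\<close>.\<close>

lemma flat_exp_has_derivative:
  "(flat_exp j has_real_derivative flat_exp (j + 2) t - real j * flat_exp (j + 1) t) (at t)"
proof (cases t "0::real" rule: linorder_cases)
  case less
  have "((\<lambda>t. 0) has_real_derivative 0) (at t)" by simp
  then have "(flat_exp j has_real_derivative 0) (at t)"
    by (rule has_field_derivative_transform_within_open[of _ _ _ "{..<0}"])
      (use less in \<open>auto simp: flat_exp_def\<close>)
  then show ?thesis using less by (simp add: flat_exp_def)
next
  case greater
  have "((\<lambda>t. exp (- (1 / t)) * inverse t ^ j) has_real_derivative
      exp (- (1 / t)) * inverse t ^ (j + 2) - real j * (exp (- (1 / t)) * inverse t ^ (j + 1))) (at t)"
    using greater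
    \<comment> \<open>The power rule produces the exponent \<open>j - 1\<close> in the natural
      numbers, hence the case split on \<open>j\<close>.\<close>
    by (auto intro!: derivative_eq_intros simp: power_numeral_reduce)
       (cases j; simp add: divide_inverse algebra_simps)
  then have "(flat_exp j has_real_derivative
      exp (- (1 / t)) * inverse t ^ (j + 2) - real j * (exp (- (1 / t)) * inverse t ^ (j + 1))) (at t)"
    by (rule has_field_derivative_transform_within_open[of _ _ _ "{0<..}"])
      (use greater in \<open>auto simp: flat_exp_def field_simps\<close>)
  then show ?thesis using greater by (simp add: flat_exp_def field_simps)
next
  case equal
  \<comment> \<open>With \<open>s = inverse h\<close> the quotient from the right is
    \<open>s ^ (j + 1) / exp s\<close>, where \<open>s\<close> tends to infinity.\<close>
  have "((\<lambda>h. flat_exp j h / h) \<longlongrightarrow> 0) (at_right 0)"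
  proof (rule Lim_transform_eventually)
    show "((\<lambda>h. inverse h ^ (j + 1) / exp (inverse h)) \<longlongrightarrow> 0) (at_right (0::real))"
      using tendsto_power_div_exp_0 filterlim_inverse_at_top_right by (rule filterlim_compose)
    show "\<forall>\<^sub>F h in at_right 0. inverse h ^ (j + 1) / exp (inverse h) = flat_exp j h / h"
      unfolding eventually_at_filter
      by (intro always_eventually) (auto simp: flat_exp_def exp_minus field_simps)
  qed
  moreover have "((\<lambda>h. flat_exp j h / h) \<longlongrightarrow> 0) (at_left 0)"
    by (rule Lim_transform_eventually[OF tendsto_const])
      (auto simp: flat_exp_def eventually_at_filter)
  ultimately have "((\<lambda>h. flat_exp j h / h) \<longlongrightarrow> 0) (at 0)"
    using filterlim_split_at by blast
  then show ?thesis using equal by (simp add: DERIV_def flat_exp_def)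
qed

section \<open>Calculus of k times continuously differentiable functions\<close>

text \<open>The recursion tests continuity only at its bottom level; one level higher it comes from
  differentiability.\<close>

lemma Ck_Suc_imp: "Ck (Suc k) f \<Longrightarrow> Ck k f"
proof (induction k arbitrary: f)
  case 0
  then show ?case
    by (auto intro!: continuous_at_imp_continuous_on differentiable_imp_continuous_within)
next
  case (Suc k)
  then show ?case by (metis Ck.simps(2))
qed

lemma Ck_imp_continuous: "Ck k f \<Longrightarrow> continuous_on UNIV f"
  by (induction k arbitrary: f) (auto dest: Ck_Suc_imp simp del: Ck.simps(2))

lemma smooth_imp_continuous: "smooth f \<Longrightarrow> continuous_on UNIV f"
  by (auto simp: smooth_def intro: Ck_imp_continuous)

lemma smooth_imp_continuous_pd: "smooth f \<Longrightarrow> continuous_on UNIV (pd i f)"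
  unfolding smooth_def by (metis Ck.simps)

lemma pd_eqI: "(f has_derivative f') (at x) \<Longrightarrow> f' (axis i 1) = c \<Longrightarrow> pd i f x = c"
  unfolding pd_def by (metis frechet_derivative_at)

lemma Ck_const: "Ck k (\<lambda>x. c)"
proof (induction k arbitrary: c)
  case (Suc k)
  have "pd i (\<lambda>x. c) = (\<lambda>x. 0)" for i
    by (intro ext pd_eqI[OF has_derivative_const]) simp
  then show ?case using Suc by simp
qed simp

lemma Ck_add: "Ck k f \<Longrightarrow> Ck k g \<Longrightarrow> Ck k (\<lambda>x. f x + g x)"
proof (induction k arbitrary: f g)
  case 0
  then show ?case by (simp add: continuous_on_add)
next
  case (Suc k)
  then have d: "f differentiable at x" "g differentiable at x" for x by auto
  have "pd i (\<lambda>x. f x + g x) = (\<lambda>x. pd i f x + pd i g x)" for i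
    by (intro ext pd_eqI[OF has_derivative_add[OF d[unfolded frechet_derivative_works]]])
      (simp add: pd_def)
  then show ?case using Suc d by simp
qed

lemma Ck_mult: "Ck k f \<Longrightarrow> Ck k g \<Longrightarrow> Ck k (\<lambda>x. f x * g x)"
proof (induction k arbitrary: f g)
  case 0
  then show ?case by (simp add: continuous_on_mult)
next
  case (Suc k)
  then have d: "f differentiable at x" "g differentiable at x" for x by auto
  have "pd i (\<lambda>x. f x * g x) = (\<lambda>x. f x * pd i g x + pd i f x * g x)" for i
    by (intro ext pd_eqI[OF has_derivative_mult[OF d[unfolded frechet_derivative_works]]])
      (simp add: pd_def)
  \<comment> \<open>The product rule leaves one factor undifferentiated, so the induction hypothesis
    also needs \<open>f\<close> and \<open>g\<close> themselves at order \<open>k\<close>.\<close>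
  moreover have "Ck k f" "Ck k g" using Suc.prems by (auto intro: Ck_Suc_imp simp del: Ck.simps)
  ultimately show ?case using Suc d by (simp add: Ck_add)
qed

lemma Ck_prod: "finite A \<Longrightarrow> (\<And>i. i \<in> A \<Longrightarrow> Ck k (f i)) \<Longrightarrow> Ck k (\<lambda>x. \<Prod>i\<in>A. f i x)"
  by (induction A rule: finite_induct) (auto intro: Ck_const Ck_mult)

lemma smooth_diff: "smooth f \<Longrightarrow> smooth g \<Longrightarrow> smooth (\<lambda>x. f x - g x)"
  using Ck_add[of _ f "\<lambda>x. - 1 * g x"] Ck_mult[OF Ck_const, of _ g "-1"]
  by (simp add: smooth_def)

lemma smooth_differentiable: "smooth f \<Longrightarrow> f differentiable at x"
  unfolding smooth_def by (metis Ck.simps(2))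

lemma pd_diff:
  assumes "smooth f" "smooth g"
  shows "pd i (\<lambda>x. f x - g x) x = pd i f x - pd i g x"
  by (rule pd_eqI[OF has_derivative_diff[OF assms[THEN smooth_differentiable, unfolded frechet_derivative_works]]])
    (simp add: pd_def)

text \<open>Each partial derivative is a linear combination of the same functions with
  \<open>j + 2\<close> and \<open>j + 1\<close> in place of \<open>j\<close>, so the induction must
  leave \<open>j\<close> arbitrary. Affine arguments in a single coordinate are those of the factors
  of \<open>box_bump\<close>.\<close>

lemma Ck_flat_exp_affine: "Ck k (\<lambda>x. flat_exp j (c * x $ i + d))"
proof (induction k arbitrary: j)
  case 0
  have "continuous_on UNIV (flat_exp j)"
    by (meson DERIV_continuous_on flat_exp_has_derivative has_field_derivative_at_within)
  then show ?case
    by (auto intro!: continuous_on_compose2[of UNIV "flat_exp j"] continuous_intros)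
next
  case (Suc k)
  let ?h = "\<lambda>j x. flat_exp j (c * x $ i + d) :: real"
  have D: "(?h j has_derivative
      (\<lambda>v. (c * v $ i) * (flat_exp (j + 2) (c * x $ i + d) - real j * flat_exp (j + 1) (c * x $ i + d)))) (at x)"
    for x
  proof (rule DERIV_compose_FDERIV[OF flat_exp_has_derivative])
    have "((\<lambda>x. c * x $ i) has_derivative (\<lambda>v. c * v $ i)) (at x)"
      by (intro bounded_linear_imp_has_derivative bounded_linear_const_mult bounded_linear_vec_nth)
    from has_derivative_add[OF this has_derivative_const, of d]
    show "((\<lambda>x. c * x $ i + d) has_derivative (\<lambda>v. c * v $ i)) (at x)" by simp
  qed
  have "pd l (?h j) = (\<lambda>x. (c * axis l 1 $ i) * (?h (j + 2) x + (- real j) * ?h (j + 1) x))" for l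
    by (intro ext pd_eqI[OF D]) (simp add: algebra_simps)
  moreover have "Ck k (\<lambda>x. (c * axis l 1 $ i) * (?h (j + 2) x + (- real j) * ?h (j + 1) x))" for l
    by (intro Ck_mult Ck_add Ck_const Suc)
  ultimately show ?case using D by (auto simp: differentiable_def)
qed

text \<open>The shift by \<open>1\<close> keeps the support at distance \<open>1 / n\<close> from the boundary of the box.\<close>

definition box_bump :: "real^2 \<Rightarrow> real^2 \<Rightarrow> nat \<Rightarrow> sfield" where
  "box_bump a b n x =
     (\<Prod>i\<in>UNIV. flat_exp 0 (real n * (x $ i - a $ i) - 1) * flat_exp 0 (real n * (b $ i - x $ i) - 1))"

lemma flat_exp_0_bounds: "0 \<le> flat_exp 0 t" "flat_exp 0 t \<le> 1"
  by (auto simp: flat_exp_def)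

text \<open>The bound is uniform in \<open>n\<close>, as dominated convergence will require.\<close>

lemma box_bump_bounds: "\<bar>box_bump a b n x\<bar> \<le> 1"
  unfolding box_bump_def abs_prod
  by (intro prod_le_1) (auto simp: abs_mult flat_exp_0_bounds intro!: mult_le_one)

lemma smooth_box_bump: "smooth (box_bump a b n)"
proof -
  have "Ck k (\<lambda>x. flat_exp 0 (real n * (x $ i - a $ i) - 1))" for k i
    using Ck_flat_exp_affine[of k 0 "real n" i "- real n * a $ i - 1"] by (simp add: algebra_simps)
  moreover have "Ck k (\<lambda>x. flat_exp 0 (real n * (b $ i - x $ i) - 1))" for k i
    using Ck_flat_exp_affine[of k 0 "- real n" i "real n * b $ i - 1"] by (simp add: algebra_simps)
  ultimately show ?thesis
    unfolding smooth_def box_bump_def[abs_def] by (intro allI Ck_prod Ck_mult) auto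
qed

text \<open>The closed box makes the support compact; the open box keeps it inside any domain that
  contains \<open>box a b\<close>.\<close>

lemma box_bump_support:
  "closure {x. box_bump a b n x \<noteq> 0} \<subseteq> cbox (\<chi> i. a $ i + 1 / n) (\<chi> i. b $ i - 1 / n) \<inter> box a b"
proof (cases "n = 0")
  \<comment> \<open>For \<open>n = 0\<close> every factor is \<open>flat_exp 0 (- 1) = 0\<close>, so
    the support is empty.\<close>
  case True
  then show ?thesis by (auto simp: box_bump_def flat_exp_def)
next
  case False
  have "{x. box_bump a b n x \<noteq> 0} \<subseteq> cbox (\<chi> i. a $ i + 1 / n) (\<chi> i. b $ i - 1 / n)"
    using False by (auto simp: box_bump_def flat_exp_def mem_box_cart field_simps split: if_splits)
      (metis less_eq_real_def)+
  then have "closure {x. box_bump a b n x \<noteq> 0} \<subseteq> cbox (\<chi> i. a $ i + 1 / n) (\<chi> i. b $ i - 1 / n)"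
    by (rule closure_minimal) auto
  moreover have "cbox (\<chi> i. a $ i + 1 / n) (\<chi> i. b $ i - 1 / n) \<subseteq> box a b"
  proof
    fix x assume x: "x \<in> cbox (\<chi> i. a $ i + 1 / n) (\<chi> i. b $ i - 1 / n)"
    have "1 / real n > 0" using False by simp
    moreover have "a $ i + 1 / n \<le> x $ i \<and> x $ i \<le> b $ i - 1 / n" for i
      using x by (simp add: mem_box_cart)
    ultimately have "a $ i < x $ i \<and> x $ i < b $ i" for i
      by (smt (verit))
    then show "x \<in> box a b" by (simp add: mem_box_cart)
  qed
  ultimately show ?thesis by blast
qed

lemma box_bump_in_test_functions: "box a b \<subseteq> \<Omega> \<Longrightarrow> box_bump a b n \<in> test_functions \<Omega>"
  using smooth_box_bump box_bump_support[of a b n]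
  by (auto simp: test_functions_def compact_eq_bounded_closed intro: bounded_subset[OF bounded_cbox])

text \<open>For positive \<open>s\<close> the argument tends to infinity, where
  \<open>exp (- (1 / t))\<close> tends to 1. Otherwise the argument is never positive and all terms
  are 0.\<close>

lemma flat_exp_tendsto: "(\<lambda>n. flat_exp 0 (real n * s - 1)) \<longlonglongrightarrow> (if s > 0 then 1 else 0)"
proof (cases "s > 0")
  case True
  have lim: "filterlim (\<lambda>n. real n * s - 1) at_top sequentially"
    using True by real_asymp
  have "((\<lambda>t. exp (- (1 / t))) \<longlongrightarrow> 1) (at_top :: real filter)" by real_asymp
  moreover have "\<forall>\<^sub>F t in at_top. exp (- (1 / t)) = flat_exp 0 t"
    using eventually_gt_at_top[of 0] by eventually_elim (simp add: flat_exp_def)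
  ultimately have "(flat_exp 0 \<longlongrightarrow> 1) at_top" by (rule Lim_transform_eventually)
  then show ?thesis using filterlim_compose[OF _ lim] True by simp
next
  case False
  then have "real n * s - 1 \<le> 0" for n
    by (smt (verit) mult_nonneg_nonpos of_nat_0_le_iff)
  then have "flat_exp 0 (real n * s - 1) = 0" for n by (simp add: flat_exp_def not_less)
  then show ?thesis using False by simp
qed

text \<open>The convergence holds at every point: on a face of the box one factor is 0 for all
  \<open>n\<close>, which matches the open box.\<close>

lemma box_bump_tendsto: "(\<lambda>n. box_bump a b n x) \<longlonglongrightarrow> indicator (box a b) x"
proof -
  have "(\<lambda>n. box_bump a b n x) \<longlonglongrightarrow>
      (\<Prod>i\<in>UNIV. (if x $ i - a $ i > 0 then 1 else 0) * (if b $ i - x $ i > 0 then 1 else 0))"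
    unfolding box_bump_def by (intro tendsto_prod tendsto_mult flat_exp_tendsto)
  also have "(\<Prod>i\<in>UNIV. (if x $ i - a $ i > 0 then 1 else 0) * (if b $ i - x $ i > 0 then 1 else 0))
      = (indicator (box a b) x :: real)"
    by (auto simp: indicator_def mem_box_cart)
  finally show ?thesis .
qed

section \<open>The fundamental lemma of the calculus of variations\<close>

text \<open>Open boxes form an intersection-stable generator of the Borel sets, and the sets over
  which \<open>f\<close> has integral 0 are closed under complements and countable disjoint unions.
  Hence all Borel sets are among them. The hypothesis \<open>total\<close> serves the complements,
  the whole space being no box.\<close>

lemma AE_zero_if_box_integrals_zero:
  fixes f :: "'a::euclidean_space \<Rightarrow> real"
  assumes f: "integrable lborel f"
    and total: "(LINT x|lborel. f x) = 0"
    and boxes: "\<And>a b. set_lebesgue_integral lborel (box a b) f = 0"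
  shows "AE x in lborel. f x = 0"
proof (rule sigma_finite_measure.density_zero[OF sigma_finite_lborel f])
  fix A :: "'a set"
  let ?G = "range (\<lambda>(a, b). box a b :: 'a set)"
  assume "A \<in> sets lborel"
  then have A: "A \<in> sigma_sets UNIV ?G" by (simp add: borel_eq_box)
  have G: "B \<in> sets lborel" if "B \<in> sigma_sets UNIV ?G" for B
    using that by (simp add: borel_eq_box)
  have int: "set_integrable lborel B f" if "B \<in> sets lborel" for B
    using f that unfolding set_integrable_def by (rule integrable_mult_indicator[rotated])
  have "Int_stable ?G" "?G \<subseteq> Pow UNIV"
    by (force simp: Int_stable_def box_Int_box)+
  from this A show "set_lebesgue_integral lborel A f = 0"
  proof (induction rule: sigma_sets_induct_disjoint)
    case (basic B)
    then show ?case using boxes by auto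
  next
    case empty
    show ?case by (simp add: set_lebesgue_integral_def)
  next
    case (compl B)
    have B: "B \<in> sets lborel" by (rule G[OF compl(1)])
    have "set_lebesgue_integral lborel ((UNIV - B) \<union> B) f =
        set_lebesgue_integral lborel (UNIV - B) f + set_lebesgue_integral lborel B f"
      using B by (intro set_integral_Un int) auto
    then show ?case using compl total by (simp add: set_lebesgue_integral_def)
  next
    case (union B)
    have m: "B i \<in> sets lborel" for i using union by (intro G) auto
    have "set_lebesgue_integral lborel (\<Union>i. B i) f = (\<Sum>i. set_lebesgue_integral lborel (B i) f)"
      using m union(1) by (intro lebesgue_integral_countable_add int sets.countable_UN)
        (auto simp: disjoint_family_on_def)
    then show ?case using union by simp
  qed
qed

text \<open>Localizes the previous lemma to a box and moves it from Borel to Lebesgue measurable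
  functions: \<open>f\<close>, cut off outside the box, agrees almost everywhere with a Borel
  function \<open>g\<close>.\<close>

lemma AE_zero_on_box_if_subbox_integrals_zero:
  fixes f :: "'a::euclidean_space \<Rightarrow> real"
  assumes f: "set_integrable lebesgue (box a b) f"
    and boxes: "\<And>c d. box c d \<subseteq> box a b \<Longrightarrow> set_lebesgue_integral lebesgue (box c d) f = 0"
  shows "AE x in lebesgue. x \<in> box a b \<longrightarrow> f x = 0"
proof -
  let ?F = "\<lambda>x. indicator (box a b) x *\<^sub>R f x"
  have F: "integrable lebesgue ?F" using f by (simp add: set_integrable_def)
  obtain g where g[measurable]: "g \<in> borel_measurable lborel" and ae: "AE x in lborel. ?F x = g x"
    using completion_ex_borel_measurable_real[OF borel_measurable_integrable[OF F]] by blast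
  note ae' = AE_completion[OF ae]
  have gL: "g \<in> borel_measurable lebesgue" by (rule measurable_completion[OF g])
  have "integrable lebesgue g"
    using integrable_cong_AE[OF borel_measurable_integrable[OF F] gL ae'] F by blast
  then have int: "integrable lborel g" using integrable_completion[OF g] by blast
  have *: "set_lebesgue_integral lborel B g = set_lebesgue_integral lebesgue (B \<inter> box a b) f"
    if B[measurable]: "B \<in> sets borel" for B
  proof -
    have "set_lebesgue_integral lborel B g = (LINT x|lebesgue. indicator B x *\<^sub>R g x)"
      unfolding set_lebesgue_integral_def by (rule integral_completion[symmetric]) measurable
    also have "\<dots> = (LINT x|lebesgue. indicator B x *\<^sub>R ?F x)"
    proof (rule integral_cong_AE)
      have B': "B \<in> sets lebesgue" using B by simp
      show "(\<lambda>x. indicat_real B x *\<^sub>R ?F x) \<in> borel_measurable lebesgue"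
        by (intro borel_measurable_integrable integrable_mult_indicator[OF B' F])
      show "(\<lambda>x. indicat_real B x *\<^sub>R g x) \<in> borel_measurable lebesgue"
        by (intro measurable_completion) measurable
      show "AE x in lebesgue. indicat_real B x *\<^sub>R g x = indicat_real B x *\<^sub>R ?F x"
        using ae' by eventually_elim simp
    qed
    finally show ?thesis by (simp add: set_lebesgue_integral_def indicator_inter_arith mult.assoc)
  qed
  have "AE x in lborel. g x = 0"
  proof (rule AE_zero_if_box_integrals_zero[OF int])
    show "(LINT x|lborel. g x) = 0"
      \<comment> \<open>With \<open>B = UNIV\<close> what remains is the integral over
        \<open>box a b\<close> itself.\<close>
      using *[of UNIV] boxes[of a b] by (simp add: set_lebesgue_integral_def)
    fix c d :: 'a
    show "set_lebesgue_integral lborel (box c d) g = 0"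
      \<comment> \<open>The intersection of two boxes is the box with the larger lower and the
        smaller upper bound in each coordinate.\<close>
      using boxes[of "\<Sum>i\<in>Basis. max (c \<bullet> i) (a \<bullet> i) *\<^sub>R i" "\<Sum>i\<in>Basis. min (d \<bullet> i) (b \<bullet> i) *\<^sub>R i"]
      by (simp add: *[OF borel_open[OF open_box]] flip: box_Int_box)
  qed
  with ae have "AE x in lborel. ?F x = 0" by eventually_elim simp
  from AE_completion[OF this] show ?thesis by eventually_elim (auto simp: indicator_def)
qed

text \<open>Bumps converge to the indicator of a box and are dominated by 1, so \<open>g\<close>
  integrates to 0 over every open box inside \<Omega> and vanishes almost everywhere there.
  Countably many such boxes cover \<Omega>, so the exceptional null sets add up to a null
  set.\<close>

lemma AE_zero_if_test_integrals_zero: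
  fixes g :: sfield
  assumes \<Omega>: "open \<Omega>" and g: "integrable (lebesgue_on \<Omega>) g"
    and test: "\<And>\<phi>. \<phi> \<in> test_functions \<Omega> \<Longrightarrow> (LINT x|lebesgue_on \<Omega>. g x * \<phi> x) = 0"
  shows "AE x in lebesgue_on \<Omega>. g x = 0"
proof -
  have \<Omega>L: "\<Omega> \<in> sets lebesgue" using \<Omega> by auto
  have sub: "set_integrable lebesgue B g" if "B \<in> sets lebesgue" "B \<subseteq> \<Omega>" for B
  proof (rule set_integrable_subset[OF _ that])
    show "set_integrable lebesgue \<Omega> g"
      using g \<Omega>L by (simp add: set_integrable_def integrable_restrict_space)
  qed
  have zero: "set_lebesgue_integral lebesgue (box a b) g = 0" if box: "box a b \<subseteq> \<Omega>" for a b
  proof -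
    have "(\<lambda>n. LINT x|lebesgue_on \<Omega>. g x * box_bump a b n x)
        \<longlonglongrightarrow> (LINT x|lebesgue_on \<Omega>. g x * indicator (box a b) x)"
    proof (rule integral_dominated_convergence[where w = "\<lambda>x. norm (g x)"])
      have cont: "box_bump a b n \<in> borel_measurable (lebesgue_on \<Omega>)" for n
        using \<Omega>L smooth_imp_continuous[OF smooth_box_bump]
        by (intro continuous_imp_measurable_on_sets_lebesgue) (auto intro: continuous_on_subset)
      show "(\<lambda>x. g x * box_bump a b n x) \<in> borel_measurable (lebesgue_on \<Omega>)" for n
        using borel_measurable_integrable[OF g] cont by (rule borel_measurable_times)
      have "(indicator (box a b) :: sfield) \<in> borel_measurable (lebesgue_on \<Omega>)"
        by (rule borel_measurable_LIMSEQ_metric[OF cont box_bump_tendsto])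
      then show "(\<lambda>x. g x * indicator (box a b) x) \<in> borel_measurable (lebesgue_on \<Omega>)"
        using borel_measurable_integrable[OF g] by (intro borel_measurable_times)
      show "integrable (lebesgue_on \<Omega>) (\<lambda>x. norm (g x))" using g by simp
      show "AE x in lebesgue_on \<Omega>. (\<lambda>n. g x * box_bump a b n x) \<longlonglongrightarrow> g x * indicator (box a b) x"
        by (intro AE_I2 tendsto_mult tendsto_const box_bump_tendsto)
      show "AE x in lebesgue_on \<Omega>. norm (g x * box_bump a b n x) \<le> norm (g x)" for n
        using box_bump_bounds by (intro AE_I2) (auto simp: abs_mult intro: mult_left_le)
    qed
    then have "(LINT x|lebesgue_on \<Omega>. g x * indicator (box a b) x) = 0"
      using test[OF box_bump_in_test_functions[OF box]] by (simp add: LIMSEQ_const_iff)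
    moreover have "(LINT x|lebesgue_on \<Omega>. g x * indicator (box a b) x) =
        set_lebesgue_integral lebesgue (box a b) g"
      using \<Omega>L box unfolding set_lebesgue_integral_def
      by (subst integral_restrict_space)
        (auto intro!: Bochner_Integration.integral_cong simp: indicator_def)
    ultimately show ?thesis by simp
  qed
  obtain D where D: "countable D" "D \<subseteq> Pow \<Omega>" "\<And>X. X \<in> D \<Longrightarrow> \<exists>a b. X = box a b" "\<Union>D = \<Omega>"
    using open_countable_Union_open_box[OF \<Omega>] by metis
  have "AE x in lebesgue. \<forall>X\<in>D. x \<in> X \<longrightarrow> g x = 0"
  proof (rule AE_ball_countable'[OF _ D(1)])
    fix X assume X: "X \<in> D"
    then obtain a b where ab: "X = box a b" using D by blast
    have "box a b \<subseteq> \<Omega>" using D X ab by blast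
    then show "AE x in lebesgue. x \<in> X \<longrightarrow> g x = 0"
      unfolding ab by (intro AE_zero_on_box_if_subbox_integrals_zero sub zero) auto
  qed
  then have "AE x in lebesgue. x \<in> \<Omega> \<longrightarrow> g x = 0"
    by eventually_elim (use D in auto)
  then show ?thesis using \<Omega>L by (simp add: AE_restrict_space_iff)
qed

section \<open>Weak derivatives and traces\<close>

lemma power2_norm_diff_le:
  fixes x y :: "'a::real_normed_vector"
  shows "(norm (x - y))\<^sup>2 \<le> 2 * (norm x)\<^sup>2 + 2 * (norm y)\<^sup>2"
proof -
  have "(norm (x - y))\<^sup>2 \<le> (norm x + norm y)\<^sup>2"
    by (intro power_mono norm_triangle_ineq4) simp
  then show ?thesis
    using sum_squares_bound[of "norm x" "norm y"] by (simp add: power2_sum)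
qed

text \<open>No integrability is assumed: a non-integrable function has integral 0 by default, so the
  radicand is never negative.\<close>

lemma l2_norm_power2: "(l2_norm \<Omega> f)\<^sup>2 = (LINT x|lebesgue_on \<Omega>. (norm (f x))\<^sup>2)"
  unfolding l2_norm_def by (intro real_sqrt_pow2 Bochner_Integration.integral_nonneg) simp

lemma l2_norm_nonneg [simp]: "0 \<le> l2_norm \<Omega> f"
  unfolding l2_norm_def by (intro real_sqrt_ge_zero Bochner_Integration.integral_nonneg) simp

lemma l2_ip_self: "l2_ip \<Omega> f f = (l2_norm \<Omega> f)\<^sup>2"
  by (simp add: l2_norm_power2 l2_ip_def power2_norm_eq_inner)

lemma L2_integrable_inner:
  assumes "f \<in> L2 \<Omega>" "g \<in> L2 \<Omega>"
  shows "integrable (lebesgue_on \<Omega>) (\<lambda>x. f x \<bullet> g x)"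
proof (rule Bochner_Integration.integrable_bound)
  show "integrable (lebesgue_on \<Omega>) (\<lambda>x. (norm (f x))\<^sup>2 + (norm (g x))\<^sup>2)"
    using assms by (auto simp: L2_def)
  show "(\<lambda>x. f x \<bullet> g x) \<in> borel_measurable (lebesgue_on \<Omega>)"
    using assms by (auto simp: L2_def)
  have "\<bar>v \<bullet> w\<bar> \<le> (norm v)\<^sup>2 + (norm w)\<^sup>2" for v w :: 'a
    using Cauchy_Schwarz_ineq2[of v w] sum_squares_bound[of "norm v" "norm w"]
      mult_nonneg_nonneg[OF norm_ge_zero norm_ge_zero, of v w] by linarith
  then show "AE x in lebesgue_on \<Omega>. norm (f x \<bullet> g x) \<le> norm ((norm (f x))\<^sup>2 + (norm (g x))\<^sup>2)"
    by (intro AE_I2) simp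
qed

lemma L2_integrable_mult:
  "f \<in> L2 \<Omega> \<Longrightarrow> g \<in> L2 \<Omega> \<Longrightarrow> integrable (lebesgue_on \<Omega>) (\<lambda>x. f x * g x :: real)"
  using L2_integrable_inner[of f \<Omega> g] by (simp add: inner_commute)

lemma L2_diff:
  assumes "f \<in> L2 \<Omega>" "g \<in> L2 \<Omega>"
  shows "(\<lambda>x. f x - g x) \<in> L2 \<Omega>"
proof -
  have "integrable (lebesgue_on \<Omega>) (\<lambda>x. (norm (f x - g x))\<^sup>2)"
  proof (rule Bochner_Integration.integrable_bound)
    show "integrable (lebesgue_on \<Omega>) (\<lambda>x. 2 * (norm (f x))\<^sup>2 + 2 * (norm (g x))\<^sup>2)"
      using assms by (auto simp: L2_def)
    show "(\<lambda>x. (norm (f x - g x))\<^sup>2) \<in> borel_measurable (lebesgue_on \<Omega>)"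
      using assms by (auto simp: L2_def)
  qed (intro AE_I2, simp add: power2_norm_diff_le)
  then show ?thesis using assms by (auto simp: L2_def)
qed

text \<open>A crude substitute for Minkowski's inequality. The constant 2 is harmless because the
  bound only serves to show that norms tend to 0.\<close>

lemma l2_norm_diff_le:
  assumes "f \<in> L2 \<Omega>" "g \<in> L2 \<Omega>"
  shows "l2_norm \<Omega> (\<lambda>x. f x - g x) \<le> 2 * (l2_norm \<Omega> f + l2_norm \<Omega> g)"
proof (rule power2_le_imp_le)
  have "(l2_norm \<Omega> (\<lambda>x. f x - g x))\<^sup>2 \<le> (LINT x|lebesgue_on \<Omega>. 2 * (norm (f x))\<^sup>2 + 2 * (norm (g x))\<^sup>2)"
    unfolding l2_norm_power2 using assms L2_diff[OF assms]
    by (intro integral_mono power2_norm_diff_le) (auto simp: L2_def)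
  also have "\<dots> = 2 * (l2_norm \<Omega> f)\<^sup>2 + 2 * (l2_norm \<Omega> g)\<^sup>2"
    unfolding l2_norm_power2 using assms by (subst Bochner_Integration.integral_add) (auto simp: L2_def)
  also have "\<dots> \<le> (2 * (l2_norm \<Omega> f + l2_norm \<Omega> g))\<^sup>2"
    by (simp add: power2_eq_square algebra_simps)
  finally show "(l2_norm \<Omega> (\<lambda>x. f x - g x))\<^sup>2 \<le> (2 * (l2_norm \<Omega> f + l2_norm \<Omega> g))\<^sup>2" .
qed simp

text \<open>Integrates the nonnegative square of \<open>norm (f x - g x)\<close>. It absorbs the
  product of the old and the new error in the energy estimate.\<close>

lemma two_l2_ip_le:
  assumes "f \<in> L2 \<Omega>" "g \<in> L2 \<Omega>"
  shows "2 * l2_ip \<Omega> f g \<le> (l2_norm \<Omega> f)\<^sup>2 + (l2_norm \<Omega> g)\<^sup>2"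
proof -
  have "2 * (v \<bullet> w) \<le> (norm v)\<^sup>2 + (norm w)\<^sup>2" for v w :: 'a
    using zero_le_power2[of "norm (v - w)"]
    by (simp add: power2_norm_eq_inner inner_diff inner_commute)
  then have "(LINT x|lebesgue_on \<Omega>. 2 * (f x \<bullet> g x)) \<le> (LINT x|lebesgue_on \<Omega>. (norm (f x))\<^sup>2 + (norm (g x))\<^sup>2)"
    using assms by (intro integral_mono) (auto simp: L2_def intro!: L2_integrable_inner)
  then show ?thesis
    using assms unfolding l2_norm_power2 l2_ip_def
    by (subst (asm) Bochner_Integration.integral_add) (auto simp: L2_def)
qed

lemma l2_ip_diff_left:
  assumes "f \<in> L2 \<Omega>" "g \<in> L2 \<Omega>" "h \<in> L2 \<Omega>"
  shows "l2_ip \<Omega> (\<lambda>x. f x - g x) h = l2_ip \<Omega> f h - l2_ip \<Omega> g h"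
  using assms by (simp add: l2_ip_def inner_diff_left L2_integrable_inner)

lemma l2_ip_scaleR_left: "l2_ip \<Omega> (\<lambda>x. c *\<^sub>R f x) h = c * l2_ip \<Omega> f h"
  by (simp add: l2_ip_def)

lemma L2_vec:
  assumes "\<And>i. cmp v i \<in> L2 \<Omega>"
  shows "v \<in> L2 \<Omega>"
proof -
  have "integrable (lebesgue_on \<Omega>) (\<lambda>x. \<Sum>i\<in>UNIV. cmp v i x * cmp v i x)"
    using assms by (intro Bochner_Integration.integrable_sum L2_integrable_mult)
  moreover have "(norm (v x))\<^sup>2 = (\<Sum>i\<in>UNIV. cmp v i x * cmp v i x)" for x
    by (simp add: power2_norm_eq_inner inner_vec_def cmp_def)
  moreover have "v \<in> borel_measurable (lebesgue_on \<Omega>)"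
  proof (subst borel_measurable_euclidean_space, intro ballI)
    fix b :: "real^2" assume "b \<in> Basis"
    then obtain i where "b = axis i 1" by (auto simp: Basis_vec_def)
    then show "(\<lambda>x. v x \<bullet> b) \<in> borel_measurable (lebesgue_on \<Omega>)"
      using assms[of i] by (simp add: L2_def inner_axis cmp_def[abs_def])
  qed
  ultimately show ?thesis by (simp add: L2_def)
qed

section \<open>Uniqueness and linearity of weak derivatives\<close>

text \<open>Membership in \<open>H1\<close> supplies the witness that makes the choice in
  \<open>wpd\<close> meaningful.\<close>

lemma wpd_L2_weak:
  assumes "f \<in> H1 \<Omega>"
  shows "wpd \<Omega> i f \<in> L2 \<Omega>" "is_weak_pd \<Omega> i f (wpd \<Omega> i f)"
proof -
  have "\<exists>g. g \<in> L2 \<Omega> \<and> is_weak_pd \<Omega> i f g" using assms by (auto simp: H1_def)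
  from someI_ex[OF this] show "wpd \<Omega> i f \<in> L2 \<Omega>" "is_weak_pd \<Omega> i f (wpd \<Omega> i f)"
    by (auto simp: wpd_def)
qed

lemma H1_imp_L2: "f \<in> H1 \<Omega> \<Longrightarrow> f \<in> L2 \<Omega>"
  by (simp add: H1_def)

lemma H1_vec_imp_L2: "v \<in> H1_vec \<Omega> \<Longrightarrow> v \<in> L2 \<Omega>"
  by (intro L2_vec H1_imp_L2) (simp add: H1_vec_def)

lemma cmp_diff: "cmp (\<lambda>x. u x - v x) i = (\<lambda>x. cmp u i x - cmp v i x)"
  by (simp add: cmp_def)

text \<open>Openness feeds the fundamental lemma. Boundedness makes the measure finite and the
  closure compact, so that functions continuous up to the boundary are square integrable.\<close>

locale bounded_domain =
  fixes \<Omega> :: "(real^2) set"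
  assumes open_domain: "open \<Omega>" and bounded_domain: "bounded \<Omega>"
begin

lemma domain_lebesgue [measurable]: "\<Omega> \<in> sets lebesgue"
  using open_domain by auto

lemma finite_measure_domain: "finite_measure (lebesgue_on \<Omega>)"
proof
  have "emeasure lebesgue \<Omega> < \<infinity>"
    using bounded_set_imp_lmeasurable[OF bounded_domain domain_lebesgue] by (simp add: fmeasurable_def)
  then show "emeasure (lebesgue_on \<Omega>) (space (lebesgue_on \<Omega>)) \<noteq> \<infinity>"
    by (simp add: emeasure_restrict_space)
qed

lemma continuous_imp_L2:
  fixes f :: "real^2 \<Rightarrow> 'a::euclidean_space"
  assumes "continuous_on (closure \<Omega>) f"
  shows "f \<in> L2 \<Omega>"
proof -
  have meas: "f \<in> borel_measurable (lebesgue_on \<Omega>)"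
    using assms closure_subset
    by (intro continuous_imp_measurable_on_sets_lebesgue) (auto intro: continuous_on_subset)
  have "compact (f ` closure \<Omega>)"
    using assms bounded_domain by (intro compact_continuous_image) auto
  then obtain B where B: "\<And>x. x \<in> closure \<Omega> \<Longrightarrow> norm (f x) \<le> B"
    using compact_imp_bounded[of "f ` closure \<Omega>"] by (auto simp: bounded_iff)
  have "integrable (lebesgue_on \<Omega>) (\<lambda>x. (norm (f x))\<^sup>2)"
  proof (rule finite_measure.integrable_const_bound[OF finite_measure_domain, where B = "B\<^sup>2"])
    show "AE x in lebesgue_on \<Omega>. norm ((norm (f x))\<^sup>2) \<le> B\<^sup>2"
      using B closure_subset by (intro AE_I2) (auto intro!: power_mono)
    show "(\<lambda>x. (norm (f x))\<^sup>2) \<in> borel_measurable (lebesgue_on \<Omega>)"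
      using meas by measurable
  qed
  with meas show ?thesis by (simp add: L2_def)
qed

lemma smooth_imp_L2: "smooth \<phi> \<Longrightarrow> \<phi> \<in> L2 \<Omega>" "smooth \<phi> \<Longrightarrow> pd i \<phi> \<in> L2 \<Omega>"
  by (rule continuous_imp_L2[OF continuous_on_subset[OF _ subset_UNIV]],
      rule smooth_imp_continuous smooth_imp_continuous_pd, assumption)+

lemma integrable_L2:
  fixes f :: sfield
  assumes "f \<in> L2 \<Omega>"
  shows "integrable (lebesgue_on \<Omega>) f"
  using L2_integrable_mult[OF assms continuous_imp_L2[of "\<lambda>x. 1"]] by simp

lemma is_weak_pd_diff:
  assumes L2: "f \<in> L2 \<Omega>" "f' \<in> L2 \<Omega>" "g \<in> L2 \<Omega>" "g' \<in> L2 \<Omega>"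
    and weak: "is_weak_pd \<Omega> i f g" "is_weak_pd \<Omega> i f' g'"
  shows "is_weak_pd \<Omega> i (\<lambda>x. f x - f' x) (\<lambda>x. g x - g' x)"
  unfolding is_weak_pd_def
proof
  fix \<phi> assume \<phi>: "\<phi> \<in> test_functions \<Omega>"
  then have "smooth \<phi>" by (simp add: test_functions_def)
  note phi = smooth_imp_L2[OF this]
  show "(LINT x|lebesgue_on \<Omega>. (f x - f' x) * pd i \<phi> x) = - (LINT x|lebesgue_on \<Omega>. (g x - g' x) * \<phi> x)"
    using weak \<phi> L2 phi by (simp add: left_diff_distrib L2_integrable_mult is_weak_pd_def)
qed

text \<open>Against a test function \<open>g\<close> and \<open>g'\<close> have the same integral,
  determined by \<open>f\<close>, so the fundamental lemma applies to \<open>g - g'\<close>.\<close>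

lemma weak_pd_unique:
  assumes L2: "g \<in> L2 \<Omega>" "g' \<in> L2 \<Omega>"
    and weak: "is_weak_pd \<Omega> i f g" "is_weak_pd \<Omega> i f g'"
  shows "AE x in lebesgue_on \<Omega>. g x = g' x"
proof -
  have "AE x in lebesgue_on \<Omega>. g x - g' x = 0"
  proof (rule AE_zero_if_test_integrals_zero[OF open_domain])
    show "integrable (lebesgue_on \<Omega>) (\<lambda>x. g x - g' x)"
      using L2 by (intro integrable_L2 L2_diff)
    fix \<phi> assume \<phi>: "\<phi> \<in> test_functions \<Omega>"
    then have "smooth \<phi>" by (simp add: test_functions_def)
    note phi = smooth_imp_L2[OF this]
    have "(LINT x|lebesgue_on \<Omega>. g x * \<phi> x) = (LINT x|lebesgue_on \<Omega>. g' x * \<phi> x)"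
      using weak[unfolded is_weak_pd_def, THEN bspec, OF \<phi>] by linarith
    then show "(LINT x|lebesgue_on \<Omega>. (g x - g' x) * \<phi> x) = 0"
      using L2 phi by (simp add: left_diff_distrib L2_integrable_mult)
  qed
  then show ?thesis by simp
qed

lemma H1_diff:
  assumes "f \<in> H1 \<Omega>" "g \<in> H1 \<Omega>"
  shows "(\<lambda>x. f x - g x) \<in> H1 \<Omega>"
  unfolding H1_def
proof (intro CollectI conjI allI)
  show "(\<lambda>x. f x - g x) \<in> L2 \<Omega>" using assms by (intro L2_diff H1_imp_L2)
  fix i
  have "is_weak_pd \<Omega> i (\<lambda>x. f x - g x) (\<lambda>x. wpd \<Omega> i f x - wpd \<Omega> i g x)"
    by (rule is_weak_pd_diff; rule assms[THEN H1_imp_L2] assms[THEN wpd_L2_weak(1)]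
        assms[THEN wpd_L2_weak(2)])
  moreover have "(\<lambda>x. wpd \<Omega> i f x - wpd \<Omega> i g x) \<in> L2 \<Omega>"
    using assms[THEN wpd_L2_weak(1)] by (rule L2_diff)
  ultimately show "\<exists>h\<in>L2 \<Omega>. is_weak_pd \<Omega> i (\<lambda>x. f x - g x) h" by (rule bexI)
qed

text \<open>The left side is a choice independent of those on the right. The difference on the right
  is also a weak derivative of \<open>f - g\<close>, so uniqueness gives equality, though only
  almost everywhere.\<close>

lemma wpd_diff:
  assumes "f \<in> H1 \<Omega>" "g \<in> H1 \<Omega>"
  shows "AE x in lebesgue_on \<Omega>. wpd \<Omega> i (\<lambda>x. f x - g x) x = wpd \<Omega> i f x - wpd \<Omega> i g x"
  by (rule weak_pd_unique[OF wpd_L2_weak(1) L2_diff wpd_L2_weak(2) is_weak_pd_diff];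
      rule assms H1_diff[OF assms] assms[THEN H1_imp_L2] assms[THEN wpd_L2_weak(1)]
        assms[THEN wpd_L2_weak(2)])

lemma H1_vec_diff: "u \<in> H1_vec \<Omega> \<Longrightarrow> v \<in> H1_vec \<Omega> \<Longrightarrow> (\<lambda>x. u x - v x) \<in> H1_vec \<Omega>"
  by (simp add: H1_vec_def cmp_diff H1_diff)

lemma wgrad_diff:
  assumes "u \<in> H1_vec \<Omega>" "v \<in> H1_vec \<Omega>"
  shows "AE x in lebesgue_on \<Omega>. wgrad \<Omega> (\<lambda>x. u x - v x) x = wgrad \<Omega> u x - wgrad \<Omega> v x"
proof -
  have "AE x in lebesgue_on \<Omega>. \<forall>i j. wpd \<Omega> j (cmp (\<lambda>x. u x - v x) i) x
      = wpd \<Omega> j (cmp u i) x - wpd \<Omega> j (cmp v i) x"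
    unfolding AE_all_countable cmp_diff using assms by (auto simp: H1_vec_def intro!: wpd_diff)
  then show ?thesis by eventually_elim (simp add: wgrad_def vec_eq_iff)
qed

section \<open>Differences of traces and the boundary condition of the error\<close>

text \<open>The difference of the two approximating sequences approximates the difference, in the
  domain and on \<Gamma>.\<close>

lemma has_trace_diff:
  assumes \<Gamma>: "\<Gamma> \<in> sets borel" and f: "f \<in> H1 \<Omega>" "has_trace \<Omega> \<Gamma> f g"
    and f': "f' \<in> H1 \<Omega>" "has_trace \<Omega> \<Gamma> f' g'"
  shows "has_trace \<Omega> \<Gamma> (\<lambda>x. f x - f' x) (\<lambda>x. g x - g' x)"
proof -
  let ?S = "arc_length_measure"
  \<comment> \<open>\<open>sets borel\<close> is already a sigma-algebra, so
    \<open>measure_of\<close> adds no further measurable sets.\<close>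
  have sets_S [measurable_cong]: "sets ?S = sets borel"
    unfolding arc_length_measure_def using sets.sigma_sets_eq[of borel] by simp
  note \<Gamma> [measurable]
  obtain \<phi> where \<phi>: "\<And>k. smooth (\<phi> k)"
      "(\<lambda>k. l2_norm \<Omega> (\<lambda>x. f x - \<phi> k x)) \<longlonglongrightarrow> 0"
      "\<And>i. (\<lambda>k. l2_norm \<Omega> (\<lambda>x. wpd \<Omega> i f x - pd i (\<phi> k) x)) \<longlonglongrightarrow> 0"
      "(\<lambda>k. \<integral>\<^sup>+x\<in>\<Gamma>. ennreal ((\<phi> k x - g x)\<^sup>2) \<partial>?S) \<longlonglongrightarrow> 0"
    and g: "g \<in> borel_measurable (restrict_space ?S \<Gamma>)"
    using f(2) unfolding has_trace_def by blast
  obtain \<phi>' where \<phi>': "\<And>k. smooth (\<phi>' k)"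
      "(\<lambda>k. l2_norm \<Omega> (\<lambda>x. f' x - \<phi>' k x)) \<longlonglongrightarrow> 0"
      "\<And>i. (\<lambda>k. l2_norm \<Omega> (\<lambda>x. wpd \<Omega> i f' x - pd i (\<phi>' k) x)) \<longlonglongrightarrow> 0"
      "(\<lambda>k. \<integral>\<^sup>+x\<in>\<Gamma>. ennreal ((\<phi>' k x - g' x)\<^sup>2) \<partial>?S) \<longlonglongrightarrow> 0"
    and g': "g' \<in> borel_measurable (restrict_space ?S \<Gamma>)"
    using f'(2) unfolding has_trace_def by blast
  let ?\<psi> = "\<lambda>k x. \<phi> k x - \<phi>' k x"
  \<comment> \<open>Used for the functions and for their derivatives. Only the norms of
    \<open>h k\<close> and \<open>h1 k - h2 k\<close> are compared, since for weak derivatives the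
    functions agree only almost everywhere.\<close>
  have squeeze: "(\<lambda>k. l2_norm \<Omega> (h k)) \<longlonglongrightarrow> 0"
    if "\<And>k. h1 k \<in> L2 \<Omega>" "\<And>k. h2 k \<in> L2 \<Omega>"
      and h: "\<And>k. l2_norm \<Omega> (h k) = l2_norm \<Omega> (\<lambda>x. h1 k x - h2 k x)"
      and "(\<lambda>k. l2_norm \<Omega> (h1 k)) \<longlonglongrightarrow> 0" "(\<lambda>k. l2_norm \<Omega> (h2 k)) \<longlonglongrightarrow> 0"
    for h h1 h2 :: "nat \<Rightarrow> sfield"
  proof (rule tendsto_sandwich[OF _ _ tendsto_const])
    show "(\<lambda>k. 2 * (l2_norm \<Omega> (h1 k) + l2_norm \<Omega> (h2 k))) \<longlonglongrightarrow> 0"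
      using tendsto_mult_left[OF tendsto_add[OF that(4,5)], of 2] by simp
    show "\<forall>\<^sub>F k in sequentially. l2_norm \<Omega> (h k) \<le> 2 * (l2_norm \<Omega> (h1 k) + l2_norm \<Omega> (h2 k))"
      unfolding h using that(1,2) by (intro always_eventually allI l2_norm_diff_le)
  qed simp
  have "(\<lambda>k. l2_norm \<Omega> (\<lambda>x. (f x - f' x) - ?\<psi> k x)) \<longlonglongrightarrow> 0"
    by (rule squeeze[OF L2_diff[OF H1_imp_L2[OF f(1)] smooth_imp_L2(1)[OF \<phi>(1)]]
          L2_diff[OF H1_imp_L2[OF f'(1)] smooth_imp_L2(1)[OF \<phi>'(1)]] _ \<phi>(2) \<phi>'(2)])
      (simp add: algebra_simps)
  moreover have "(\<lambda>k. l2_norm \<Omega> (\<lambda>x. wpd \<Omega> i (\<lambda>x. f x - f' x) x - pd i (?\<psi> k) x)) \<longlonglongrightarrow> 0" for i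
  proof (rule squeeze[OF _ _ _ \<phi>(3) \<phi>'(3)])
    note L2 = wpd_L2_weak(1)[OF f(1), of i] wpd_L2_weak(1)[OF f'(1), of i]
      wpd_L2_weak(1)[OF H1_diff[OF f(1) f'(1)], of i]
    note pd_psi = pd_diff[OF \<phi>(1) \<phi>'(1)]
    fix k
    show A: "(\<lambda>x. wpd \<Omega> i f x - pd i (\<phi> k) x) \<in> L2 \<Omega>"
      and B: "(\<lambda>x. wpd \<Omega> i f' x - pd i (\<phi>' k) x) \<in> L2 \<Omega>"
      by (rule L2_diff[OF L2(1) smooth_imp_L2(2)[OF \<phi>(1)]] L2_diff[OF L2(2) smooth_imp_L2(2)[OF \<phi>'(1)]])+
    have C: "(\<lambda>x. wpd \<Omega> i (\<lambda>x. f x - f' x) x - pd i (?\<psi> k) x) \<in> L2 \<Omega>"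
      using L2(3) smooth_imp_L2(2)[OF smooth_diff[OF \<phi>(1) \<phi>'(1)]] by (rule L2_diff)
    show "l2_norm \<Omega> (\<lambda>x. wpd \<Omega> i (\<lambda>x. f x - f' x) x - pd i (?\<psi> k) x) =
        l2_norm \<Omega> (\<lambda>x. (wpd \<Omega> i f x - pd i (\<phi> k) x) - (wpd \<Omega> i f' x - pd i (\<phi>' k) x))"
      unfolding l2_norm_def
    proof (rule arg_cong[where f = sqrt], rule integral_cong_AE)
      show "AE x in lebesgue_on \<Omega>. (norm (wpd \<Omega> i (\<lambda>x. f x - f' x) x - pd i (?\<psi> k) x))\<^sup>2 =
          (norm ((wpd \<Omega> i f x - pd i (\<phi> k) x) - (wpd \<Omega> i f' x - pd i (\<phi>' k) x)))\<^sup>2"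
        using wpd_diff[OF f(1) f'(1), of i] 
        by eventually_elim (simp only: pd_psi, rule arg_cong[where f = "\<lambda>t. (norm t)\<^sup>2"], simp)
    qed (use C L2_diff[OF A B] in \<open>auto simp: L2_def\<close>)
  qed
  moreover have "(\<lambda>k. \<integral>\<^sup>+x\<in>\<Gamma>. ennreal ((?\<psi> k x - (g x - g' x))\<^sup>2) \<partial>?S) \<longlonglongrightarrow> 0"
  proof (rule tendsto_sandwich[OF _ _ tendsto_const])
    \<comment> \<open>The datum \<open>h\<close> is measurable only relative to \<Gamma>;
      multiplying by the indicator of this Borel set gives measurability on the whole plane.\<close>
    have meas: "(\<lambda>x. ennreal ((s x - h x)\<^sup>2) * indicator \<Gamma> x) \<in> borel_measurable ?S"
      if "smooth s" "h \<in> borel_measurable (restrict_space ?S \<Gamma>)" for s h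
    proof -
      have "s \<in> borel_measurable ?S"
        using smooth_imp_continuous[OF that(1)]
        by (simp add: borel_measurable_continuous_onI measurable_cong_sets[OF sets_S refl])
      then have "s \<in> borel_measurable (restrict_space ?S \<Gamma>)"
        by (rule measurable_restrict_space1)
      then have "(\<lambda>x. ennreal ((s x - h x)\<^sup>2)) \<in> borel_measurable (restrict_space ?S \<Gamma>)"
        using that(2) by measurable
      then show ?thesis
        by (subst (asm) borel_measurable_restrict_space_iff_ennreal) (use \<Gamma> in \<open>auto simp: sets_S\<close>)
    qed
    have "(\<integral>\<^sup>+x\<in>\<Gamma>. ennreal ((?\<psi> k x - (g x - g' x))\<^sup>2) \<partial>?S) \<le>
        2 * (\<integral>\<^sup>+x\<in>\<Gamma>. ennreal ((\<phi> k x - g x)\<^sup>2) \<partial>?S) + 2 * (\<integral>\<^sup>+x\<in>\<Gamma>. ennreal ((\<phi>' k x - g' x)\<^sup>2) \<partial>?S)"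
      for k
    proof -
      have le: "ennreal ((?\<psi> k x - (g x - g' x))\<^sup>2) * indicator \<Gamma> x \<le>
          2 * (ennreal ((\<phi> k x - g x)\<^sup>2) * indicator \<Gamma> x) + 2 * (ennreal ((\<phi>' k x - g' x)\<^sup>2) * indicator \<Gamma> x)"
        for x
      proof -
        have "(?\<psi> k x - (g x - g' x))\<^sup>2 \<le> 2 * (\<phi> k x - g x)\<^sup>2 + 2 * (\<phi>' k x - g' x)\<^sup>2"
          using power2_norm_diff_le[of "\<phi> k x - g x" "\<phi>' k x - g' x"] by (simp add: algebra_simps)
        then have "ennreal ((?\<psi> k x - (g x - g' x))\<^sup>2) \<le> ennreal (2 * (\<phi> k x - g x)\<^sup>2 + 2 * (\<phi>' k x - g' x)\<^sup>2)"
          by (rule ennreal_leI)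
        also have "\<dots> = 2 * ennreal ((\<phi> k x - g x)\<^sup>2) + 2 * ennreal ((\<phi>' k x - g' x)\<^sup>2)"
          by (simp add: ennreal_mult')
        finally show ?thesis by (simp add: indicator_def)
      qed
      have "(\<integral>\<^sup>+x\<in>\<Gamma>. ennreal ((?\<psi> k x - (g x - g' x))\<^sup>2) \<partial>?S) \<le>
          (\<integral>\<^sup>+x. 2 * (ennreal ((\<phi> k x - g x)\<^sup>2) * indicator \<Gamma> x)
            + 2 * (ennreal ((\<phi>' k x - g' x)\<^sup>2) * indicator \<Gamma> x) \<partial>?S)"
        using le by (rule nn_integral_mono)
      then show ?thesis
        using meas[OF \<phi>(1) g] meas[OF \<phi>'(1) g'] by (simp add: nn_integral_add nn_integral_cmult)
    qed
    then show "\<forall>\<^sub>F k in sequentially. (\<integral>\<^sup>+x\<in>\<Gamma>. ennreal ((?\<psi> k x - (g x - g' x))\<^sup>2) \<partial>?S) \<le>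
        2 * (\<integral>\<^sup>+x\<in>\<Gamma>. ennreal ((\<phi> k x - g x)\<^sup>2) \<partial>?S) + 2 * (\<integral>\<^sup>+x\<in>\<Gamma>. ennreal ((\<phi>' k x - g' x)\<^sup>2) \<partial>?S)"
      by (intro always_eventually allI)
    show "(\<lambda>k. 2 * (\<integral>\<^sup>+x\<in>\<Gamma>. ennreal ((\<phi> k x - g x)\<^sup>2) \<partial>?S)
        + 2 * (\<integral>\<^sup>+x\<in>\<Gamma>. ennreal ((\<phi>' k x - g' x)\<^sup>2) \<partial>?S)) \<longlonglongrightarrow> 0"
      using tendsto_add[OF ennreal_tendsto_cmult[OF _ \<phi>(4), of 2] ennreal_tendsto_cmult[OF _ \<phi>'(4), of 2]]
      by simp
  qed simp
  moreover have "(\<lambda>x. g x - g' x) \<in> borel_measurable (restrict_space ?S \<Gamma>)"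
    using g g' by measurable
  ultimately show ?thesis
    unfolding has_trace_def
    by (intro conjI exI[of _ ?\<psi>] allI smooth_diff \<phi>(1) \<phi>'(1))
qed

text \<open>The common datum \<open>g\<close> cancels in the traces. This is where the error gets
  the boundary condition of a test function.\<close>

lemma H1_dir_diff:
  assumes "\<Gamma> \<in> sets borel" "u \<in> H1_dir \<Omega> \<Gamma> g" "v \<in> H1_dir \<Omega> \<Gamma> g"
  shows "(\<lambda>x. u x - v x) \<in> H1_zero \<Omega> \<Gamma>"
proof -
  have "has_trace \<Omega> \<Gamma> (\<lambda>x. cmp u i x - cmp v i x) (\<lambda>x. cmp g i x - cmp g i x)" for i
    using assms by (intro has_trace_diff) (auto simp: H1_dir_def H1_vec_def)
  then show ?thesis
    using assms by (simp add: H1_zero_def H1_dir_def H1_vec_diff cmp_diff) (simp add: cmp_def)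
qed

section \<open>The forms and the energy estimate\<close>

lemma integrable_wgrad_inner:
  assumes "u \<in> H1_vec \<Omega>" "v \<in> H1_vec \<Omega>"
  shows "integrable (lebesgue_on \<Omega>) (\<lambda>x. wgrad \<Omega> u x \<bullet> wgrad \<Omega> v x)"
  unfolding wgrad_def inner_vec_def using assms
  by (auto simp: H1_vec_def intro!: Bochner_Integration.integrable_sum L2_integrable_mult wpd_L2_weak(1))

lemma a_form_diff_left:
  assumes "u \<in> H1_vec \<Omega>" "v \<in> H1_vec \<Omega>" "w \<in> H1_vec \<Omega>"
  shows "a_form \<Omega> (\<lambda>x. u x - v x) w = a_form \<Omega> u w - a_form \<Omega> v w"
proof -
  note int = integrable_wgrad_inner[OF assms(1,3)] integrable_wgrad_inner[OF assms(2,3)]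
    integrable_wgrad_inner[OF H1_vec_diff[OF assms(1,2)] assms(3)]
  have "a_form \<Omega> (\<lambda>x. u x - v x) w =
      (LINT x|lebesgue_on \<Omega>. wgrad \<Omega> u x \<bullet> wgrad \<Omega> w x - wgrad \<Omega> v x \<bullet> wgrad \<Omega> w x)"
    unfolding a_form_def
  proof (rule integral_cong_AE)
    show "AE x in lebesgue_on \<Omega>. wgrad \<Omega> (\<lambda>x. u x - v x) x \<bullet> wgrad \<Omega> w x =
        wgrad \<Omega> u x \<bullet> wgrad \<Omega> w x - wgrad \<Omega> v x \<bullet> wgrad \<Omega> w x"
      using wgrad_diff[OF assms(1,2)] by eventually_elim (simp add: inner_diff_left)
  qed (use int in auto)
  then show ?thesis using int by (simp add: a_form_def)
qed

lemma a_form_self: "a_form \<Omega> v v = (l2_norm \<Omega> (wgrad \<Omega> v))\<^sup>2"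
  by (simp add: a_form_def l2_norm_power2 power2_norm_eq_inner)

lemma integrable_mult_wdiv:
  assumes "v \<in> H1_vec \<Omega>" "p \<in> pressure_space \<Omega> \<T>"
  shows "integrable (lebesgue_on \<Omega>) (\<lambda>x. p x * wdiv \<Omega> v x)"
proof -
  have "p \<in> L2 \<Omega>"
    using assms(2) by (intro continuous_imp_L2) (simp add: pressure_space_def lagrange_space_def)
  then show ?thesis
    unfolding wdiv_def trace_def wgrad_def sum_distrib_left using assms(1)
    by (auto simp: H1_vec_def
        intro!: Bochner_Integration.integrable_sum L2_integrable_mult wpd_L2_weak(1))
qed

text \<open>The divergence of \<open>v\<close> drops out of the integrand almost everywhere, so the
  error inherits the discrete incompressibility of the velocity.\<close>

lemma b_form_diff_solenoidal:
  assumes "u \<in> H1_vec \<Omega>" "v \<in> H1_vec \<Omega>" "p \<in> pressure_space \<Omega> \<T>"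
    and solenoidal: "AE x in lebesgue_on \<Omega>. wdiv \<Omega> v x = 0"
  shows "b_form \<Omega> (\<lambda>x. u x - v x) p = b_form \<Omega> u p"
  unfolding b_form_def
proof (rule integral_cong_AE)
  show "AE x in lebesgue_on \<Omega>. p x * wdiv \<Omega> (\<lambda>x. u x - v x) x = p x * wdiv \<Omega> u x"
    using wgrad_diff[OF assms(1,2)] solenoidal
    by eventually_elim (simp add: wdiv_def trace_def sum_subtractf)
qed (use assms integrable_mult_wdiv H1_vec_diff in auto)

section \<open>The convective form on finite element velocities\<close>

lemma continuous_cmp_velocity:
  "v \<in> velocity_space \<Omega> \<T> \<Longrightarrow> continuous_on (closure \<Omega>) (\<lambda>x. v x $ i)"
  by (simp add: velocity_space_def lagrange_space_def cmp_def)

text \<open>A product of three square integrable functions need not be integrable. Here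
  \<open>w\<close> and \<open>v\<close> are continuous up to the boundary, so their components
  multiply to a square integrable function, which is paired with a weak derivative of
  \<open>u\<close>.\<close>

lemma integrable_convection:
  assumes "u \<in> H1_vec \<Omega>" "w \<in> velocity_space \<Omega> \<T>" "v \<in> velocity_space \<Omega> \<T>"
  shows "integrable (lebesgue_on \<Omega>) (\<lambda>x. (wgrad \<Omega> u x *v w x) \<bullet> v x)"
proof -
  have "(wgrad \<Omega> u x *v w x) \<bullet> v x = (\<Sum>i\<in>UNIV. \<Sum>j\<in>UNIV. wpd \<Omega> j (cmp u i) x * (w x $ j * v x $ i))" for x
    by (simp add: inner_vec_def matrix_vector_mult_def wgrad_def sum_distrib_right mult.assoc)
  moreover have "(\<lambda>x. w x $ j * v x $ i) \<in> L2 \<Omega>" for i j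
    using assms by (intro continuous_imp_L2 continuous_on_mult continuous_cmp_velocity)
  ultimately show ?thesis
    using assms by (auto simp: H1_vec_def
        intro!: Bochner_Integration.integrable_sum L2_integrable_mult wpd_L2_weak(1))
qed

lemma c_form_diff_1:
  assumes "w \<in> velocity_space \<Omega> \<T>" "w' \<in> velocity_space \<Omega> \<T>" "u \<in> H1_vec \<Omega>" "v \<in> velocity_space \<Omega> \<T>"
  shows "c_form \<Omega> (\<lambda>x. w x - w' x) u v = c_form \<Omega> w u v - c_form \<Omega> w' u v"
  using integrable_convection[OF assms(3) _ assms(4)] assms(1,2)
  by (simp add: c_form_def matrix_vector_mult_diff_distrib inner_diff_left)

lemma c_form_diff_3:
  assumes "w \<in> velocity_space \<Omega> \<T>" "u \<in> H1_vec \<Omega>" "v \<in> velocity_space \<Omega> \<T>" "v' \<in> velocity_space \<Omega> \<T>"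
  shows "c_form \<Omega> w u (\<lambda>x. v x - v' x) = c_form \<Omega> w u v - c_form \<Omega> w u v'"
  using integrable_convection[OF assms(2,1)] assms(3,4)
  by (simp add: c_form_def inner_diff_right)

text \<open>Unlike the other two arguments, this one enters through its weak gradient, so linearity
  rests on the almost everywhere identity \<open>wgrad_diff\<close>.\<close>

lemma c_form_diff_2:
  assumes "w \<in> velocity_space \<Omega> \<T>" "u \<in> H1_vec \<Omega>" "u' \<in> H1_vec \<Omega>" "v \<in> velocity_space \<Omega> \<T>"
  shows "c_form \<Omega> w (\<lambda>x. u x - u' x) v = c_form \<Omega> w u v - c_form \<Omega> w u' v"
proof -
  note int = integrable_convection[OF assms(2,1,4)] integrable_convection[OF assms(3,1,4)]
    integrable_convection[OF H1_vec_diff[OF assms(2,3)] assms(1,4)]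
  have "c_form \<Omega> w (\<lambda>x. u x - u' x) v =
      (LINT x|lebesgue_on \<Omega>. (wgrad \<Omega> u x *v w x) \<bullet> v x - (wgrad \<Omega> u' x *v w x) \<bullet> v x)"
    unfolding c_form_def
  proof (rule integral_cong_AE)
    show "AE x in lebesgue_on \<Omega>. (wgrad \<Omega> (\<lambda>x. u x - u' x) x *v w x) \<bullet> v x =
        (wgrad \<Omega> u x *v w x) \<bullet> v x - (wgrad \<Omega> u' x *v w x) \<bullet> v x"
      using wgrad_diff[OF assms(2,3)]
      by eventually_elim (simp add: matrix_vector_mult_diff_rdistrib inner_diff_left)
  qed (use int in auto)
  then show ?thesis using int by (simp add: c_form_def)
qed

lemma velocity_space_diff:
  assumes "u \<in> velocity_space \<Omega> \<T>" "v \<in> velocity_space \<Omega> \<T>"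
  shows "(\<lambda>x. u x - v x) \<in> velocity_space \<Omega> \<T>"
proof -
  have "(\<lambda>x. f x - g x) \<in> lagrange_space 2 \<Omega> \<T>"
    if f: "f \<in> lagrange_space 2 \<Omega> \<T>" and g: "g \<in> lagrange_space 2 \<Omega> \<T>" for f g
    unfolding lagrange_space_def
  proof (intro CollectI conjI ballI)
    show "continuous_on (closure \<Omega>) (\<lambda>x. f x - g x)"
      using f g by (intro continuous_on_diff) (auto simp: lagrange_space_def)
    fix K assume K: "K \<in> \<T>"
    obtain c where c: "\<And>x. x \<in> K \<Longrightarrow> f x = (\<Sum>i\<le>2. \<Sum>j\<le>2 - i. c i j * (x $ 1) ^ i * (x $ 2) ^ j)"
      using f K by (auto simp: lagrange_space_def)
    obtain d where d: "\<And>x. x \<in> K \<Longrightarrow> g x = (\<Sum>i\<le>2. \<Sum>j\<le>2 - i. d i j * (x $ 1) ^ i * (x $ 2) ^ j)"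
      using g K by (auto simp: lagrange_space_def)
    show "\<exists>c. \<forall>x\<in>K. f x - g x = (\<Sum>i\<le>2. \<Sum>j\<le>2 - i. c i j * (x $ 1) ^ i * (x $ 2) ^ j)"
      by (intro exI[of _ "\<lambda>i j. c i j - d i j"] ballI)
        (simp only: c d left_diff_distrib sum_subtractf)
  qed
  then show ?thesis
    using assms by (simp add: velocity_space_def cmp_diff H1_vec_diff)
qed

text \<open>The two sides differ by \<open>c_skew \<Omega> u e e\<close>, which vanishes by skew symmetry.\<close>

lemma c_skew_error:
  assumes "u \<in> velocity_space \<Omega> \<T>" "v \<in> velocity_space \<Omega> \<T>"
  defines "e \<equiv> \<lambda>x. u x - v x"
  shows "c_skew \<Omega> u u e = c_skew \<Omega> v v e + c_skew \<Omega> e v e"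
proof -
  have e: "e \<in> velocity_space \<Omega> \<T>" unfolding e_def using assms(1,2) by (rule velocity_space_diff)
  note V = assms(1,2) e
  have H: "u \<in> H1_vec \<Omega>" "v \<in> H1_vec \<Omega>" "e \<in> H1_vec \<Omega>" using V by (auto simp: velocity_space_def)
  have "c_form \<Omega> e v e = c_form \<Omega> u v e - c_form \<Omega> v v e"
    using c_form_diff_1[OF V(1,2) H(2) V(3)] by (simp add: e_def)
  moreover have "c_form \<Omega> e e v = c_form \<Omega> u e v - c_form \<Omega> v e v"
    using c_form_diff_1[OF V(1,2) H(3) V(2)] by (simp add: e_def)
  \<comment> \<open>\<open>c_form \<Omega> u e e\<close> is expanded in its second argument here and
    in its third one below; equating the two expansions expresses the skew symmetry.\<close>
  moreover have "c_form \<Omega> u e e = c_form \<Omega> u u e - c_form \<Omega> u v e"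
    using c_form_diff_2[OF V(1) H(1,2) V(3)] by (simp add: e_def)
  moreover have "c_form \<Omega> u e e = c_form \<Omega> u e u - c_form \<Omega> u e v"
    using c_form_diff_3[OF V(1) H(3) V(1,2)] by (simp add: e_def)
  ultimately have "c_form \<Omega> u u e - c_form \<Omega> u e u
      = (c_form \<Omega> v v e - c_form \<Omega> v e v) + (c_form \<Omega> e v e - c_form \<Omega> e e v)"
    by linarith
  then show ?thesis unfolding c_skew_def by (simp only: add_divide_distrib)
qed

section \<open>The energy estimate for one time step\<close>

text \<open>The functions at the old step enter only through \<open>l2_ip\<close>, hence the weaker
  requirement \<open>H1_vec\<close> on them. It admits the desired state at the initial time, which
  is not assumed to be discrete.\<close>

lemma error_energy:
  assumes \<Gamma>: "\<Gamma>D \<in> sets borel" and dt: "dt > 0"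
    and u1: "u1 \<in> velocity_space \<Omega> \<T> \<inter> H1_dir \<Omega> \<Gamma>D g"
    and U1: "U1 \<in> velocity_space \<Omega> \<T> \<inter> H1_dir \<Omega> \<Gamma>D g"
    and u0: "u0 \<in> H1_vec \<Omega>" and U0: "U0 \<in> H1_vec \<Omega>"
    and div: "AE x in lebesgue_on \<Omega>. wdiv \<Omega> U1 x = 0"
    and p: "p \<in> pressure_space \<Omega> \<T>" "b_form \<Omega> u1 p = 0"
    and momentum: "\<And>v. v \<in> velocity_test_space \<Omega> \<Gamma>D \<T> \<Longrightarrow>
      l2_ip \<Omega> (\<lambda>x. (1 / dt) *\<^sub>R (u1 x - u0 x)) v + \<nu> * a_form \<Omega> u1 v
        + c_skew \<Omega> u1 u1 v - b_form \<Omega> v p = f_B \<Omega> \<nu> dt \<gamma> U1 U0 u1 v"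
  defines "e1 \<equiv> \<lambda>x. u1 x - U1 x" and "e0 \<equiv> \<lambda>x. u0 x - U0 x"
  shows "e1 \<in> H1_zero \<Omega> \<Gamma>D"
    and "(1 + 2 * dt * \<gamma>) * (l2_norm \<Omega> e1)\<^sup>2 + 2 * dt * \<nu> * (l2_norm \<Omega> (wgrad \<Omega> e1))\<^sup>2
      \<le> (l2_norm \<Omega> e0)\<^sup>2"
proof -
  show e1_zero: "e1 \<in> H1_zero \<Omega> \<Gamma>D"
    unfolding e1_def using \<Gamma> u1 U1 by (intro H1_dir_diff) auto
  have V: "u1 \<in> velocity_space \<Omega> \<T>" "U1 \<in> velocity_space \<Omega> \<T>" using u1 U1 by auto
  have e1_V: "e1 \<in> velocity_space \<Omega> \<T>" unfolding e1_def using V by (rule velocity_space_diff)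
  have H: "u1 \<in> H1_vec \<Omega>" "U1 \<in> H1_vec \<Omega>" "e1 \<in> H1_vec \<Omega>"
    using V e1_V by (auto simp: velocity_space_def)
  note L2 = H[THEN H1_vec_imp_L2] u0[THEN H1_vec_imp_L2] U0[THEN H1_vec_imp_L2]
  have e0_L2: "e0 \<in> L2 \<Omega>" unfolding e0_def using L2(4,5) by (rule L2_diff)
  have ip: "l2_ip \<Omega> (\<lambda>x. (1 / dt) *\<^sub>R (w x - w' x)) e1 = (l2_ip \<Omega> w e1 - l2_ip \<Omega> w' e1) / dt"
    if "w \<in> L2 \<Omega>" "w' \<in> L2 \<Omega>" for w w'
    using that L2(3) by (simp add: l2_ip_scaleR_left l2_ip_diff_left)
  have e_ip: "l2_ip \<Omega> e1 e1 = l2_ip \<Omega> u1 e1 - l2_ip \<Omega> U1 e1"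
      "l2_ip \<Omega> e0 e1 = l2_ip \<Omega> u0 e1 - l2_ip \<Omega> U0 e1"
    using l2_ip_diff_left[OF L2(1,2,3)] l2_ip_diff_left[OF L2(4,5,3)] by (auto simp: e1_def e0_def)
  have a: "a_form \<Omega> e1 e1 = a_form \<Omega> u1 e1 - a_form \<Omega> U1 e1"
    using a_form_diff_left[OF H] by (simp add: e1_def)
  have b: "b_form \<Omega> e1 p = 0"
    using b_form_diff_solenoidal[OF H(1,2) p(1) div] p(2) by (simp add: e1_def)
  have "l2_ip \<Omega> (\<lambda>x. (1 / dt) *\<^sub>R (u1 x - u0 x)) e1 + \<nu> * a_form \<Omega> u1 e1
      + c_skew \<Omega> u1 u1 e1 - b_form \<Omega> e1 p
    = l2_ip \<Omega> (\<lambda>x. (1 / dt) *\<^sub>R (U1 x - U0 x)) e1 + \<nu> * a_form \<Omega> U1 e1 + c_skew \<Omega> U1 U1 e1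
      + c_skew \<Omega> e1 U1 e1 - \<gamma> * l2_ip \<Omega> e1 e1"
    using momentum[of e1] e1_V e1_zero
    by (simp add: velocity_test_space_def f_B_def F_B_def flip: e1_def)
  \<comment> \<open>By \<open>c_skew_error\<close> the convective terms on both sides are equal, and
    the remaining terms collect into the error by linearity.\<close>
  then have "(l2_ip \<Omega> e1 e1 - l2_ip \<Omega> e0 e1) / dt + \<nu> * a_form \<Omega> e1 e1 + \<gamma> * l2_ip \<Omega> e1 e1 = 0"
    using c_skew_error[OF V] unfolding ip[OF L2(1,4)] ip[OF L2(2,5)] a b e_ip e1_def[symmetric]
    by (simp add: algebra_simps diff_divide_distrib add_divide_distrib)
  then have "(l2_ip \<Omega> e1 e1 - l2_ip \<Omega> e0 e1) + dt * (\<nu> * a_form \<Omega> e1 e1 + \<gamma> * l2_ip \<Omega> e1 e1) = 0"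
    using dt by (simp add: field_simps)
  then show "(1 + 2 * dt * \<gamma>) * (l2_norm \<Omega> e1)\<^sup>2 + 2 * dt * \<nu> * (l2_norm \<Omega> (wgrad \<Omega> e1))\<^sup>2
      \<le> (l2_norm \<Omega> e0)\<^sup>2"
    \<comment> \<open>Doubling the identity turns the product
      \<open>2 * l2_ip \<Omega> e0 e1\<close> into at most the sum of both squared norms; one of the
      two copies of the new error is used up, and the factors \<open>2 * dt\<close> remain.\<close>
    using two_l2_ip_le[OF e0_L2 L2(3)] unfolding l2_ip_self a_form_self by (simp add: algebra_simps)
qed

end

section \<open>Decay of the error over all time steps\<close>

theorem theorem4:
  fixes \<Omega> \<Gamma>D \<Gamma>N :: "(real^2) set"
    and \<T> :: "(real^2) set set"
    and \<nu> dt \<gamma> T :: real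
    and N :: nat
    and uD U :: "real \<Rightarrow> vfield"
    and u :: "nat \<Rightarrow> vfield"
    and p :: "nat \<Rightarrow> sfield"
    and f :: "nat \<Rightarrow> vfield \<Rightarrow> real"
  assumes domain: "open \<Omega>" "connected \<Omega>" "bounded \<Omega>" "\<Omega> \<noteq> {}"
    and boundary: "frontier \<Omega> = closure \<Gamma>D \<union> closure \<Gamma>N" "\<Gamma>D \<inter> \<Gamma>N = {}"
      "\<Gamma>D \<in> sets borel"
    and mesh: "is_mesh \<Omega> \<T>"
    and params: "\<nu> > 0" "dt > 0" "\<gamma> \<ge> 0" "T = real N * dt"
    and desired: "admissible_state \<Omega> \<Gamma>D uD T U"
    and desired_discrete: "\<forall>n<N. at_step dt U (n + 1) \<in> velocity_space \<Omega> \<T>"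
    and control: "\<forall>n<N. \<forall>v\<in>H1_zero \<Omega> \<Gamma>D.
      f (n + 1) v = f_B \<Omega> \<nu> dt \<gamma> (at_step dt U (n + 1)) (at_step dt U n) (u (n + 1)) v"
    and solution: "discrete_ns_solution \<Omega> \<Gamma>D \<T> \<nu> dt N uD u p f"
  shows "(\<forall>n<N. (l2_norm \<Omega> (\<lambda>x. u (n + 1) x - at_step dt U (n + 1) x))\<^sup>2
                  \<le> (l2_norm \<Omega> (\<lambda>x. u n x - at_step dt U n x))\<^sup>2) \<and>
         (\<forall>C\<^sub>P. poincare_constant \<Omega> \<Gamma>D C\<^sub>P \<longrightarrow>
            (let C\<^sub>0 = inverse C\<^sub>P in
              \<forall>n<N. (l2_norm \<Omega> (\<lambda>x. u (n + 1) x - at_step dt U (n + 1) x))\<^sup>2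
                  \<le> (1 / (1 + 2 * dt * (\<gamma> + C\<^sub>0 * \<nu>))) ^ (n + 1)
                     * (l2_norm \<Omega> (\<lambda>x. u 0 x - at_step dt U 0 x))\<^sup>2))"
proof -
  interpret bounded_domain \<Omega> using domain by unfold_locales
  define e where "e n = (\<lambda>x. u n x - at_step dt U n x)" for n
  have U: "at_step dt U n \<in> H1_dir \<Omega> \<Gamma>D (at_step dt uD n)"
      "AE x in lebesgue_on \<Omega>. wdiv \<Omega> (at_step dt U n) x = 0" if "n \<le> N" for n
  proof -
    \<comment> \<open>Both end points occur among the grid times, so the closed interval in
      \<open>admissible_state\<close> matters.\<close>
    have "real n * dt \<in> {0..T}" using that params by (auto intro: mult_right_mono)
    then show "at_step dt U n \<in> H1_dir \<Omega> \<Gamma>D (at_step dt uD n)"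
      "AE x in lebesgue_on \<Omega>. wdiv \<Omega> (at_step dt U n) x = 0"
      using desired by (auto simp: admissible_state_def at_step_def)
  qed
  have energy: "e (n + 1) \<in> H1_zero \<Omega> \<Gamma>D \<and>
      (1 + 2 * dt * \<gamma>) * (l2_norm \<Omega> (e (n + 1)))\<^sup>2 + 2 * dt * \<nu> * (l2_norm \<Omega> (wgrad \<Omega> (e (n + 1))))\<^sup>2
        \<le> (l2_norm \<Omega> (e n))\<^sup>2" if n: "n < N" for n
  proof -
    note sol = solution[unfolded discrete_ns_solution_def]
    have u: "u m \<in> velocity_space \<Omega> \<T> \<inter> H1_dir \<Omega> \<Gamma>D (at_step dt uD m)" if "m \<le> N" for m
      using sol that by blast
    have p: "p (n + 1) \<in> pressure_space \<Omega> \<T>" using sol n by blast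
    then have b: "b_form \<Omega> (u (n + 1)) (p (n + 1)) = 0" using sol n by blast
    have mom: "l2_ip \<Omega> (\<lambda>x. (1 / dt) *\<^sub>R (u (n + 1) x - u n x)) v + \<nu> * a_form \<Omega> (u (n + 1)) v
        + c_skew \<Omega> (u (n + 1)) (u (n + 1)) v - b_form \<Omega> v (p (n + 1))
        = f_B \<Omega> \<nu> dt \<gamma> (at_step dt U (n + 1)) (at_step dt U n) (u (n + 1)) v"
      if v: "v \<in> velocity_test_space \<Omega> \<Gamma>D \<T>" for v
    proof -
      have "v \<in> H1_zero \<Omega> \<Gamma>D" using v by (simp add: velocity_test_space_def)
      then have "f (n + 1) v = f_B \<Omega> \<nu> dt \<gamma> (at_step dt U (n + 1)) (at_step dt U n) (u (n + 1)) v"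
        using control n by blast
      then show ?thesis using sol n v by simp
    qed
    have U1: "at_step dt U (n + 1) \<in> velocity_space \<Omega> \<T> \<inter> H1_dir \<Omega> \<Gamma>D (at_step dt uD (n + 1))"
      using desired_discrete U(1)[of "n + 1"] n by simp
    have H: "u n \<in> H1_vec \<Omega>" "at_step dt U n \<in> H1_vec \<Omega>"
      using u[of n] U(1)[of n] n by (auto simp: H1_dir_def)
    show ?thesis
      unfolding e_def using n
      by (intro conjI error_energy[OF boundary(3) params(2) u U1 H U(2) p b mom]) auto
  qed
  have decay: "(l2_norm \<Omega> (e (n + 1)))\<^sup>2 \<le> (l2_norm \<Omega> (e n))\<^sup>2" if n: "n < N" for n
  proof -
    \<comment> \<open>Feedback and viscosity contribute nonnegative terms, and dropping them leaves
      the monotone decay without any Poincare constant.\<close>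
    have "0 \<le> 2 * dt * \<gamma> * (l2_norm \<Omega> (e (n + 1)))\<^sup>2" "0 \<le> 2 * dt * \<nu> * (l2_norm \<Omega> (wgrad \<Omega> (e (n + 1))))\<^sup>2"
      using params by auto
    then show ?thesis
      using energy[OF n, THEN conjunct2, unfolded distrib_right mult_1_left] by linarith
  qed
  have exp_decay: "(l2_norm \<Omega> (e (n + 1)))\<^sup>2 \<le> (1 / (1 + 2 * dt * (\<gamma> + inverse C * \<nu>))) ^ (n + 1) * (l2_norm \<Omega> (e 0))\<^sup>2"
    if C: "poincare_constant \<Omega> \<Gamma>D C" and "n < N" for C n
  proof -
    let ?q = "1 + 2 * dt * (\<gamma> + inverse C * \<nu>)"
    have C0: "C > 0" using C by (simp add: poincare_constant_def)
    have q: "?q > 0" using params C0 by (intro add_pos_nonneg) auto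
    have step: "(l2_norm \<Omega> (e (m + 1)))\<^sup>2 \<le> 1 / ?q * (l2_norm \<Omega> (e m))\<^sup>2" if m: "m < N" for m
    proof -
      \<comment> \<open>The error vanishes on \<Gamma>D, so the Poincare inequality applies and
        turns the viscous term into \<open>inverse C * \<nu>\<close> next to \<gamma>; together they
        form the factor \<open>?q\<close>.\<close>
      have "(l2_norm \<Omega> (e (m + 1)))\<^sup>2 \<le> C * (l2_norm \<Omega> (wgrad \<Omega> (e (m + 1))))\<^sup>2"
        using C energy[OF m] by (simp add: poincare_constant_def)
      then have "inverse C * (l2_norm \<Omega> (e (m + 1)))\<^sup>2 \<le> (l2_norm \<Omega> (wgrad \<Omega> (e (m + 1))))\<^sup>2"
        using C0 by (simp add: field_simps)
      then have "2 * dt * \<nu> * (inverse C * (l2_norm \<Omega> (e (m + 1)))\<^sup>2)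
          \<le> 2 * dt * \<nu> * (l2_norm \<Omega> (wgrad \<Omega> (e (m + 1))))\<^sup>2"
        using params by (intro mult_left_mono) auto
      then have "?q * (l2_norm \<Omega> (e (m + 1)))\<^sup>2 \<le> (l2_norm \<Omega> (e m))\<^sup>2"
        using energy[OF m] by (simp add: algebra_simps)
      then show ?thesis using q by (simp add: field_simps)
    qed
    \<comment> \<open>The bound concerns the error at \<open>n + 1\<close>, so the base case already
      takes one application of \<open>step\<close>.\<close>
    from \<open>n < N\<close> show ?thesis
    proof (induction n)
      case 0
      then show ?case using step[of 0] by simp
    next
      case (Suc n)
      have "(l2_norm \<Omega> (e (Suc n + 1)))\<^sup>2 \<le> 1 / ?q * (l2_norm \<Omega> (e (n + 1)))\<^sup>2"
        using step[of "n + 1"] Suc.prems by simp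
      also have "\<dots> \<le> 1 / ?q * ((1 / ?q) ^ (n + 1) * (l2_norm \<Omega> (e 0))\<^sup>2)"
        using Suc q by (intro mult_left_mono) auto
      finally show ?case by (simp add: mult.assoc)
    qed
  qed
  show ?thesis
    using decay exp_decay unfolding e_def Let_def by blast
qed

end
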